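(* Let $\theta\in(0,\pi/2)$, let $H=\sigma^x\otimes\sigma^x$ and let $L$ be the self-adjoint matrix given in the context. Consider the probability measure $\mu$ on $\Omega=\{1,2\}^{\mathbb N}$ such that, for any $n\ge 2$ and any $(j_1,\dots,j_n)\in\{1,2\}^n$, $\mu([j_1,\dots,j_n])=\mu_{\infty,n}(j_1,\dots,j_n)$. Then $\mu$ is invariant and ergodic for the shift map $\sigma$ acting on $\Omega$. It is not mixing and does not have a continuous Jacobian.
   Context: Let $\sigma^x=\begin{pmatrix}0&1\\1&0\end{pmatrix}$ and let $H=\sigma^x\otimes\sigma^x$ act on $\mathbb C^2\otimes\mathbb C^2$. For $n\ge 2$ let $H_n=\sum_{i=0}^{n-2}I^{\otimes i}\otimes H\otimes I^{\otimes(n-i-2)}$ on $(\mathbb C^2)^{\otimes n}$. For $\theta\in(0,\pi/2)$ let $L=\begin{pmatrix}\cos^2\theta-\sin^2\theta&2\cos\theta\sin\theta\\2\cos\theta\sin\theta&\sin^2\theta-\cos^2\theta\end{pmatrix}$, whose eigenvalues $1$ and $-1$ have the orthonormal eigenvectors $\psi_1=(\cos\theta,\sin\theta)$ and $\psi_2=(-\sin\theta,\cos\theta)$ respectively, and let $P_1,P_2$ be the orthogonal projections of $\mathbb C^2$ onto the lines spanned by $\psi_1,\psi_2$. For $\beta>0$ and $(j_1,\dots,j_n)\in\{1,2\}^n$ put $$\mu_{\beta,n}(j_1,\dots,j_n)=\frac{\mathrm{Tr}\big[e^{-\beta H_n}(P_{j_1}\otimes\cdots\otimes P_{j_n})\big]}{\mathrm{Tr}(e^{-\beta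 H_n})},\qquad \mu_{\infty,n}=\lim_{\beta\to+\infty}\mu_{\beta,n}.$$ The cylinders are $[j_1,\dots,j_n]=\{(x_1,x_2,\dots)\in\Omega: x_1=j_1,\dots,x_n=j_n\}$, and the shift is $\sigma(x_1,x_2,x_3,\dots)=(x_2,x_3,\dots)$. The Jacobian of $\mu$ is the function $J(x)=\lim_{n\to\infty}\mu([x_0,\dots,x_n])/\mu([x_1,\dots,x_n])$ for $x=(x_0,x_1,x_2,\dots)\in\Omega$, if the limit exists; for any shift-invariant measure it is well defined almost everywhere and can be seen as the Radon-Nikodym derivative of the measure over the inverse branches of $\sigma$.
   Formalization: At θ = π/4 the measure sits on two points and the constant 1 is an a.e. Jacobian, so there the formal claim is only that no continuous function is the limit J(x) at every x in Ω; for θ ≠ π/4 no continuous function equals J almost everywhere. *)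

theory Defs
  imports
    "HOL-Probability.Probability"
    "Jordan_Normal_Form.Matrix"
begin

subsection \<open>Finite-dimensional matrices\<close>

definition kronecker :: "complex mat \<Rightarrow> complex mat \<Rightarrow> complex mat" where
  "kronecker A B = Matrix.mat (dim_row A * dim_row B) (dim_col A * dim_col B)
     (\<lambda>(i, j). A $$ (i div dim_row B, j div dim_col B) * B $$ (i mod dim_row B, j mod dim_col B))"

definition tensor_list :: "complex mat list \<Rightarrow> complex mat" where
  "tensor_list As = foldr kronecker As (1\<^sub>m 1)"

definition mat_trace :: "complex mat \<Rightarrow> complex" where
  "mat_trace A = (\<Sum>i<dim_row A. A $$ (i, i))"

text \<open>The exponential series of a square matrix, summed entrywise.\<close>

definition mat_exp :: "complex mat \<Rightarrow> complex mat" where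
  "mat_exp A = Matrix.mat (dim_row A) (dim_row A)
     (\<lambda>(i, j). \<Sum>k. (A ^\<^sub>m k) $$ (i, j) / fact k)"

text \<open>The matrix of the orthogonal projection \<open>w \<mapsto> (\<langle>v, w\<rangle> / \<langle>v, v\<rangle>) v\<close> onto the line
  spanned by a nonzero vector \<open>v\<close>; see \<open>line_projection_mult_vec\<close>.\<close>

definition line_projection :: "complex Matrix.vec \<Rightarrow> complex mat" where
  "line_projection v = Matrix.mat (dim_vec v) (dim_vec v)
     (\<lambda>(i, j). vec_index v i * cnj (vec_index v j) / (v \<bullet>c v))"

lemma line_projection_mult_vec:
  assumes "dim_vec w = dim_vec v"
  shows "line_projection v *\<^sub>v w = ((w \<bullet>c v) / (v \<bullet>c v)) \<cdot>\<^sub>v v"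
  using assms
  by (intro eq_vecI)
     (auto simp: line_projection_def scalar_prod_def sum_distrib_left sum_distrib_right
        sum_divide_distrib divide_simps mult_ac intro!: sum.cong)

subsection \<open>The Hamiltonian and the observable\<close>

definition sigma_x :: "complex mat" where
  "sigma_x = mat_of_rows_list 2 [[0, 1], [1, 0]]"

definition interaction :: "complex mat" where
  "interaction = kronecker sigma_x sigma_x"

definition hamiltonian :: "nat \<Rightarrow> complex mat" where
  "hamiltonian n = foldr (+)
     (map (\<lambda>i. tensor_list (replicate i (1\<^sub>m 2) @ [interaction] @ replicate (n - i - 2) (1\<^sub>m 2)))
       [0..<n - 1])
     (0\<^sub>m (2 ^ n) (2 ^ n))"

definition observable :: "real \<Rightarrow> complex mat" where
  "observable \<theta> = mat_of_rows_list 2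
     [[of_real ((cos \<theta>)\<^sup>2 - (sin \<theta>)\<^sup>2), of_real (2 * cos \<theta> * sin \<theta>)],
      [of_real (2 * cos \<theta> * sin \<theta>), of_real ((sin \<theta>)\<^sup>2 - (cos \<theta>)\<^sup>2)]]"

text \<open>Only the indices \<open>j = 1\<close> and \<open>j = 2\<close> are meaningful.\<close>

definition observable_eigenvector :: "real \<Rightarrow> nat \<Rightarrow> complex Matrix.vec" where
  "observable_eigenvector \<theta> j =
     (if j = 1 then vec_of_list [of_real (cos \<theta>), of_real (sin \<theta>)]
      else vec_of_list [of_real (- sin \<theta>), of_real (cos \<theta>)])"

lemma observable_eigenvectors:
  "observable \<theta> *\<^sub>v observable_eigenvector \<theta> 1 = observable_eigenvector \<theta> 1"
  "observable \<theta> *\<^sub>v observable_eigenvector \<theta> 2 = - observable_eigenvector \<theta> 2"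
  "observable_eigenvector \<theta> 1 \<bullet>c observable_eigenvector \<theta> 1 = 1"
  "observable_eigenvector \<theta> 2 \<bullet>c observable_eigenvector \<theta> 2 = 1"
  "observable_eigenvector \<theta> 1 \<bullet>c observable_eigenvector \<theta> 2 = 0"
proof -
  define c s where "c = complex_of_real (cos \<theta>)" and "s = complex_of_real (sin \<theta>)"
  have *: "s * s = 1 - c * c"
    using arg_cong[OF sin_squared_eq[of \<theta>], of complex_of_real]
    by (simp add: c_def s_def power2_eq_square)
  have **: "s * (s * x) = x - c * (c * x)" for x
    by (simp only: mult.assoc[symmetric] * left_diff_distrib mult_1_left)
  have [simp]: "cnj c = c" "cnj s = s"
    by (simp_all add: c_def s_def)
  have L: "observable \<theta> = mat_of_rows_list 2
      [[c * c - s * s, 2 * c * s], [2 * c * s, s * s - c * c]]"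
    by (simp add: observable_def c_def s_def power2_eq_square)
  have E: "observable_eigenvector \<theta> 1 = vec_of_list [c, s]"
      "observable_eigenvector \<theta> 2 = vec_of_list [- s, c]"
    by (simp_all add: observable_eigenvector_def c_def s_def)
  note defs = mat_of_rows_list_def scalar_prod_def less_Suc_eq numeral_2_eq_2
  show "observable \<theta> *\<^sub>v observable_eigenvector \<theta> 1 = observable_eigenvector \<theta> 1"
    unfolding L E by (rule eq_vecI) (auto simp: defs algebra_simps * **)
  show "observable \<theta> *\<^sub>v observable_eigenvector \<theta> 2 = - observable_eigenvector \<theta> 2"
    unfolding L E by (rule eq_vecI) (auto simp: defs algebra_simps * **)
  show "observable_eigenvector \<theta> 1 \<bullet>c observable_eigenvector \<theta> 1 = 1"
    unfolding E by (simp add: defs *)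
  show "observable_eigenvector \<theta> 2 \<bullet>c observable_eigenvector \<theta> 2 = 1"
    unfolding E by (simp add: defs *)
  show "observable_eigenvector \<theta> 1 \<bullet>c observable_eigenvector \<theta> 2 = 0"
    unfolding E by (simp add: defs)
qed

definition observable_projection :: "real \<Rightarrow> nat \<Rightarrow> complex mat" where
  "observable_projection \<theta> j = line_projection (observable_eigenvector \<theta> j)"

definition gibbs_weight :: "real \<Rightarrow> real \<Rightarrow> nat list \<Rightarrow> complex" where
  "gibbs_weight \<theta> \<beta> js =
     mat_trace (mat_exp (of_real (- \<beta>) \<cdot>\<^sub>m hamiltonian (length js)) *
       tensor_list (map (observable_projection \<theta>) js)) /
     mat_trace (mat_exp (of_real (- \<beta>) \<cdot>\<^sub>m hamiltonian (length js)))"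

definition ground_weight :: "real \<Rightarrow> nat list \<Rightarrow> complex" where
  "ground_weight \<theta> js = Lim at_top (\<lambda>\<beta>. gibbs_weight \<theta> \<beta> js)"

subsection \<open>The one-sided shift on two symbols\<close>

text \<open>Sequences \<open>(x\<^sub>1, x\<^sub>2, \<dots>)\<close> are indexed from \<open>0\<close>. As a subset of \<^typ>\<open>nat \<Rightarrow> nat\<close>, with its
  product topology, \<open>Omega\<close> carries the usual topology of the Bernoulli space.\<close>

definition Omega :: "(nat \<Rightarrow> nat) set" where
  "Omega = {x. \<forall>i. x i \<in> {1, 2}}"

definition Omega_algebra :: "(nat \<Rightarrow> nat) measure" where
  "Omega_algebra = Pi\<^sub>M UNIV (\<lambda>_. count_space {1, 2})"

lemma space_Omega_algebra: "space Omega_algebra = Omega"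
  by (auto simp: Omega_algebra_def Omega_def space_PiM PiE_def Pi_def)

definition cylinder :: "nat list \<Rightarrow> (nat \<Rightarrow> nat) set" where
  "cylinder js = {x \<in> Omega. \<forall>i < length js. x i = js ! i}"

definition shift_map :: "(nat \<Rightarrow> nat) \<Rightarrow> nat \<Rightarrow> nat" where
  "shift_map x = (\<lambda>i. x (Suc i))"

subsection \<open>Ergodic theory\<close>

definition invariant_measure :: "'a measure \<Rightarrow> ('a \<Rightarrow> 'a) \<Rightarrow> bool" where
  "invariant_measure M T \<longleftrightarrow>
     T \<in> measurable M M \<and> (\<forall>A\<in>sets M. emeasure M (T -` A \<inter> space M) = emeasure M A)"

definition ergodic_measure :: "'a measure \<Rightarrow> ('a \<Rightarrow> 'a) \<Rightarrow> bool" where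
  "ergodic_measure M T \<longleftrightarrow> invariant_measure M T \<and>
     (\<forall>A\<in>sets M. T -` A \<inter> space M = A \<longrightarrow> measure M A = 0 \<or> measure M A = 1)"

definition mixing_measure :: "'a measure \<Rightarrow> ('a \<Rightarrow> 'a) \<Rightarrow> bool" where
  "mixing_measure M T \<longleftrightarrow> invariant_measure M T \<and>
     (\<forall>A\<in>sets M. \<forall>B\<in>sets M.
        (\<lambda>n. measure M ((T ^^ n) -` A \<inter> B)) \<longlonglongrightarrow> measure M A * measure M B)"

subsection \<open>Jacobians\<close>

definition jacobian_quotient :: "(nat \<Rightarrow> nat) measure \<Rightarrow> (nat \<Rightarrow> nat) \<Rightarrow> nat \<Rightarrow> real" where
  "jacobian_quotient M x n =
     measure M (cylinder (map x [0..<Suc n])) / measure M (cylinder (map x [1..<Suc n]))"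

text \<open>The limit of the quotients exists at every point of \<open>Omega\<close> and is continuous. Points where
  numerator and denominator eventually vanish are not excluded (there \<open>0 / 0 = 0\<close>), which only
  makes this property easier to satisfy and hence its negation stronger.\<close>

definition has_continuous_jacobian :: "(nat \<Rightarrow> nat) measure \<Rightarrow> bool" where
  "has_continuous_jacobian M \<longleftrightarrow>
     (\<exists>J. continuous_on Omega J \<and> (\<forall>x\<in>Omega. jacobian_quotient M x \<longlonglongrightarrow> J x))"

text \<open>The weaker property that the Jacobian, which is only defined almost everywhere in general,
  agrees almost everywhere with a continuous function.\<close>

definition has_continuous_jacobian_ae :: "(nat \<Rightarrow> nat) measure \<Rightarrow> bool" where
  "has_continuous_jacobian_ae M \<longleftrightarrow>
     (\<exists>J. continuous_on Omega J \<and> (AE x in M. jacobian_quotient M x \<longlonglongrightarrow> J x))"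

end

theory Submission
  imports Defs "HOL-Real_Asymp.Real_Asymp"
begin

text \<open>
  The bond terms of the Hamiltonian are simultaneously diagonal in the product basis built from the
  eigenvectors of \<^const>\<open>sigma_x\<close>, where they become the bonds of the antiferromagnetic Ising chain.
  The Gibbs weights are therefore Boltzmann averages over spin configurations
  (\<open>gibbs_weight_eq\<close>), and as \<open>\<beta>\<close> tends to infinity only the two alternating configurations remain
  (\<open>ground_weight_eq\<close>). Each is a product state, in which the measured outcomes are independent with
  probabilities \<open>(1 \<plusminus> sin (2 * \<theta>)) / 2\<close> alternating from site to site. Thus \<open>\<mu>\<close> is the average of
  two staggered Bernoulli measures (\<open>measure_eq_staggered_average\<close>), which the shift exchanges
  (\<open>distr_staggered_shift\<close>).

  Everything else follows from this description. Invariance is immediate. A shift-invariant set is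
  a tail event, so each staggered measure gives it the value \<open>0\<close> or \<open>1\<close>, and the two values agree
  because the measures are exchanged; hence \<open>\<mu>\<close> is ergodic. The correlation of the symbols at
  distance \<open>n\<close> depends on the parity of \<open>n\<close>, which excludes mixing.

  For the Jacobian with \<open>\<theta> \<noteq> pi / 4\<close>, the two staggered measures are mutually singular: the
  likelihood ratio tends to \<open>0\<close> almost surely (\<open>AE_likelihood_ratio_tendsto_0\<close>). A typical sequence
  hence reveals the component it belongs to, and the Jacobian depends on that component. As both
  components have full support, sequences of either type are dense, so no continuous function agrees
  with the Jacobian almost everywhere. For \<open>\<theta> = pi / 4\<close> the measure sits on two points and the
  discontinuity appears at these points when they are approached from outside the support.
\<close>

section \<open>Tensor products of matrices\<close>

lemma sum_lessThan_mult_div_mod: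
  fixes f :: "nat \<Rightarrow> nat \<Rightarrow> 'a::comm_monoid_add"
  shows "(\<Sum>k<m * n. f (k div n) (k mod n)) = (\<Sum>i<m. \<Sum>j<n. f i j)"
proof -
  have "(\<Sum>k<m * n. f (k div n) (k mod n))
      = (\<Sum>i<m. \<Sum>k\<in>{i * n..<i * n + n}. f (k div n) (k mod n))"
    by (rule sum.nat_group[symmetric])
  also have "\<dots> = (\<Sum>i<m. \<Sum>j<n. f i j)"
  proof (rule sum.cong[OF refl])
    fix i
    have "(\<Sum>k\<in>{i * n..<i * n + n}. f (k div n) (k mod n))
        = (\<Sum>j<n. f ((j + i * n) div n) ((j + i * n) mod n))"
      using sum.shift_bounds_nat_ivl[of "\<lambda>k. f (k div n) (k mod n)" 0 "i * n" n]
      by (simp add: atLeast0LessThan add.commute)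
    also have "\<dots> = (\<Sum>j<n. f i j)"
      by (rule sum.cong) auto
    finally show "(\<Sum>k\<in>{i * n..<i * n + n}. f (k div n) (k mod n)) = (\<Sum>j<n. f i j)" .
  qed
  finally show ?thesis .
qed

lemma dim_kronecker [simp]:
  "dim_row (kronecker A B) = dim_row A * dim_row B"
  "dim_col (kronecker A B) = dim_col A * dim_col B"
  by (simp_all add: kronecker_def)

lemma div_less_of_less_mult: "i < a * b \<Longrightarrow> i div b < (a::nat)"
  by (simp add: less_mult_imp_div_less)

lemma mod_less_of_less_mult: "i < a * b \<Longrightarrow> i mod b < (b::nat)"
  by (cases "b = 0") auto

lemmas index_bounds = div_less_of_less_mult mod_less_of_less_mult

lemma index_kronecker:
  "i < dim_row A * dim_row B \<Longrightarrow> j < dim_col A * dim_col B \<Longrightarrow>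
   kronecker A B $$ (i, j) =
     A $$ (i div dim_row B, j div dim_col B) * B $$ (i mod dim_row B, j mod dim_col B)"
  by (simp add: kronecker_def)

lemma index_kronecker_block:
  assumes "p < dim_row A" "i < dim_row B" "q < dim_col A" "j < dim_col B"
  shows "kronecker A B $$ (p * dim_row B + i, q * dim_col B + j) = A $$ (p, q) * B $$ (i, j)"
proof -
  have lt: "p * b + i < a * b" if "p < a" "i < b" for p i a b :: nat
    using mult_le_mono1[of "Suc p" a b] that by simp
  show ?thesis
    using assms lt[OF assms(1,2)] lt[OF assms(3,4)] by (simp add: index_kronecker)
qed

text \<open>The sum over the inner index factorizes: splitting it into quotient and remainder turns it into
  two independent sums.\<close>

lemma kronecker_mult:
  assumes "dim_col A = dim_row C" "dim_col B = dim_row D"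
  shows "kronecker A B * kronecker C D = kronecker (A * C) (B * D)"
proof (rule eq_matI)
  fix i j
  assume "i < dim_row (kronecker (A * C) (B * D))" "j < dim_col (kronecker (A * C) (B * D))"
  then have i: "i < dim_row A * dim_row B" and j: "j < dim_col C * dim_col D"
    by simp_all
  note b = index_bounds[OF i] index_bounds[OF j]
  let ?a = "\<lambda>k. A $$ (i div dim_row B, k) * C $$ (k, j div dim_col D)"
  let ?b = "\<lambda>k. B $$ (i mod dim_row B, k) * D $$ (k, j mod dim_col D)"
  have "(kronecker A B * kronecker C D) $$ (i, j)
      = (\<Sum>k<dim_row C * dim_row D. kronecker A B $$ (i, k) * kronecker C D $$ (k, j))"
    using i j assms by (simp add: scalar_prod_def atLeast0LessThan)
  also have "\<dots> = (\<Sum>k<dim_row C * dim_row D. ?a (k div dim_row D) * ?b (k mod dim_row D))"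
    using i j assms by (intro sum.cong refl) (simp add: index_kronecker)
  also have "\<dots> = (\<Sum>k<dim_row C. ?a k) * (\<Sum>k<dim_row D. ?b k)"
    by (simp add: sum_lessThan_mult_div_mod[of "\<lambda>p q. ?a p * ?b q"] sum_product)
  also have "\<dots> = kronecker (A * C) (B * D) $$ (i, j)"
    using i j b assms by (simp add: index_kronecker scalar_prod_def atLeast0LessThan)
  finally show "(kronecker A B * kronecker C D) $$ (i, j) = kronecker (A * C) (B * D) $$ (i, j)" .
qed simp_all

lemma kronecker_assoc: "kronecker (kronecker A B) C = kronecker A (kronecker B C)"
proof (rule eq_matI)
  fix i j
  assume "i < dim_row (kronecker A (kronecker B C))" "j < dim_col (kronecker A (kronecker B C))"
  then have i: "i < dim_row A * (dim_row B * dim_row C)"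
    and j: "j < dim_col A * (dim_col B * dim_col C)"
    by simp_all
  then have i': "i < dim_row A * dim_row B * dim_row C"
    and j': "j < dim_col A * dim_col B * dim_col C"
    by (simp_all add: mult.assoc)
  have pos: "0 < dim_row C" "0 < dim_col C"
    using i j by (auto intro: Nat.gr0I)
  have div: "k div b div c = k div (c * b)" and mod: "k div b mod c = k mod (c * b) div b"
    and mm: "k mod (c * b) mod b = k mod b"
    if "b > 0" for k b c :: nat
  proof -
    show "k div b div c = k div (c * b)"
      by (metis div_mult2_eq mult.commute)
    have "k mod (c * b) = b * (k div b mod c) + k mod b"
      by (metis mod_mult2_eq mult.commute)
    with that show "k div b mod c = k mod (c * b) div b" "k mod (c * b) mod b = k mod b"
      by simp_all
  qed
  show "kronecker (kronecker A B) C $$ (i, j) = kronecker A (kronecker B C) $$ (i, j)"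
    using i j i' j' index_bounds[OF i] index_bounds[OF j] index_bounds[OF i'] index_bounds[OF j']
    by (simp add: index_kronecker div[OF pos(1)] div[OF pos(2)] mod[OF pos(1)] mod[OF pos(2)]
          mm[OF pos(1)] mm[OF pos(2)] mult.assoc)
qed (simp_all add: mult.assoc)

lemma tensor_list_Nil [simp]: "tensor_list [] = 1\<^sub>m 1"
  by (simp add: tensor_list_def)

lemma tensor_list_Cons [simp]: "tensor_list (A # As) = kronecker A (tensor_list As)"
  by (simp add: tensor_list_def)

text \<open>Replaces the \<open>4 \<times> 4\<close> interaction by two \<open>2 \<times> 2\<close> factors, so that only tensor products of
  one-site matrices remain.\<close>

lemma tensor_list_split_kronecker:
  "tensor_list (As @ kronecker A B # Bs) = tensor_list (As @ A # B # Bs)"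
  by (induction As) (simp_all add: kronecker_assoc)

lemma tensor_list_carrier:
  "set As \<subseteq> carrier_mat 2 2 \<Longrightarrow> tensor_list As \<in> carrier_mat (2 ^ length As) (2 ^ length As)"
  by (induction As) auto

lemma tensor_list_mult:
  assumes "length As = length Bs" "set As \<subseteq> carrier_mat 2 2" "set Bs \<subseteq> carrier_mat 2 2"
  shows "tensor_list As * tensor_list Bs = tensor_list (map2 (*) As Bs)"
  using assms
proof (induction As Bs rule: list_induct2)
  case (Cons A As B Bs)
  then have "dim_col A = dim_row B" "dim_col (tensor_list As) = dim_row (tensor_list Bs)"
    using tensor_list_carrier[of As] tensor_list_carrier[of Bs] by auto
  with Cons show ?case
    by (simp add: kronecker_mult)
qed simp

text \<open>Basis vectors of the \<open>n\<close>-fold tensor product are labelled by bit strings of length \<open>n\<close>. The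
  most significant bit comes first, because the left factor of a Kronecker product carries the
  quotient of the index.\<close>

primrec bits_index :: "bool list \<Rightarrow> nat" where
  "bits_index [] = 0"
| "bits_index (b # bs) = of_bool b * 2 ^ length bs + bits_index bs"

lemma bits_index_less: "bits_index bs < 2 ^ length bs"
  by (induction bs) auto

lemma bits_index_inj:
  "length bs = length cs \<Longrightarrow> bits_index bs = bits_index cs \<Longrightarrow> bs = cs"
proof (induction bs cs rule: list_induct2)
  case (Cons b bs c cs)
  have "b = c \<and> bits_index bs = bits_index cs"
    using Cons bits_index_less[of bs] bits_index_less[of cs] by (cases b; cases c) auto
  with Cons show ?case
    by simp
qed simp

lemma bij_betw_bits_index: "bij_betw bits_index {bs. length bs = n} {..<2 ^ n}"
proof -
  have fin: "finite {bs :: bool list. length bs = n}" and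
    card: "card {bs :: bool list. length bs = n} = 2 ^ n"
    using finite_lists_length_eq[of "UNIV :: bool set" n] card_lists_length_eq[of "UNIV :: bool set" n]
    by simp_all
  have inj: "inj_on bits_index {bs. length bs = n}"
    by (auto intro!: inj_onI bits_index_inj)
  have "bits_index ` {bs. length bs = n} = {..<2 ^ n}"
    using bits_index_less by (intro card_subset_eq) (auto simp: card_image[OF inj] card)
  with inj show ?thesis
    by (simp add: bij_betw_def)
qed

lemma tensor_list_index_bits:
  assumes "set As \<subseteq> carrier_mat 2 2" "length bs = length As" "length cs = length As"
  shows "tensor_list As $$ (bits_index bs, bits_index cs)
    = (\<Prod>k<length As. As ! k $$ (of_bool (bs ! k), of_bool (cs ! k)))"
  using assms
proof (induction As arbitrary: bs cs)
  case (Cons A As)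
  then obtain b bs' c cs' where bs: "bs = b # bs'" and cs: "cs = c # cs'"
    by (auto simp: length_Suc_conv)
  have len: "length bs' = length As" "length cs' = length As"
    using Cons.prems by (simp_all add: bs cs)
  have T: "dim_row (tensor_list As) = 2 ^ length As" "dim_col (tensor_list As) = 2 ^ length As"
    using tensor_list_carrier[of As] Cons.prems by auto
  have Alt: "of_bool b < dim_row A" "of_bool b < dim_col A" for b
    using Cons.prems(1) by (cases b; auto)+
  have lt: "bits_index bs' < 2 ^ length As" "bits_index cs' < 2 ^ length As"
    using bits_index_less[of bs'] bits_index_less[of cs'] by (simp_all add: len)
  have "tensor_list (A # As) $$ (bits_index bs, bits_index cs)
      = A $$ (of_bool b, of_bool c) * tensor_list As $$ (bits_index bs', bits_index cs')"
    using lt index_kronecker_block[OF Alt(1)[of b] _ Alt(2)[of c], of "bits_index bs'" "tensor_list As" "bits_index cs'"]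
    by (simp only: bs cs T len bits_index.simps tensor_list_Cons)
  also have "\<dots> = (\<Prod>k<length (A # As). (A # As) ! k $$ (of_bool (bs ! k), of_bool (cs ! k)))"
    using Cons.IH[OF _ len] Cons.prems(1) by (simp add: bs cs prod.lessThan_Suc_shift del: prod.lessThan_Suc)
  finally show ?case .
qed simp

section \<open>Exponentials of diagonalized matrices\<close>

lemma mult_mat_index:
  assumes "A \<in> carrier_mat N N" "B \<in> carrier_mat N N" "i < N" "j < N"
  shows "(A * B) $$ (i, j) = (\<Sum>k<N. A $$ (i, k) * B $$ (k, j))"
  using assms by (auto simp: scalar_prod_def atLeast0LessThan)

lemma foldr_add_mat:
  assumes "set Ms \<subseteq> carrier_mat N N"
  shows "foldr (+) Ms (0\<^sub>m N N) \<in> carrier_mat N N"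
    and "i < N \<Longrightarrow> j < N \<Longrightarrow> foldr (+) Ms (0\<^sub>m N N) $$ (i, j) = (\<Sum>M\<leftarrow>Ms. M $$ (i, j))"
proof -
  show *: "foldr (+) Ms (0\<^sub>m N N) \<in> carrier_mat N N"
    using assms by (induction Ms) auto
  show "foldr (+) Ms (0\<^sub>m N N) $$ (i, j) = (\<Sum>M\<leftarrow>Ms. M $$ (i, j))" if "i < N" "j < N"
    using assms
  proof (induction Ms)
    case (Cons M Ms)
    have "foldr (+) Ms (0\<^sub>m N N) \<in> carrier_mat N N"
      using Cons.prems by (induction Ms) auto
    with Cons that show ?case
      by (auto simp: index_add_mat)
  qed (use that in simp)
qed

text \<open>The columns of \<open>U\<close> are eigenvectors of \<open>A\<close>. Stating this entrywise avoids introducing the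
  diagonal matrix of eigenvalues.\<close>

lemma pow_mat_eigencolumns:
  assumes A: "A \<in> carrier_mat N N" and U: "U \<in> carrier_mat N N"
    and AU: "\<And>i j. i < N \<Longrightarrow> j < N \<Longrightarrow> (A * U) $$ (i, j) = U $$ (i, j) * d j"
    and ij: "i < N" "j < N"
  shows "(A ^\<^sub>m k * U) $$ (i, j) = U $$ (i, j) * d j ^ k"
  using ij
proof (induction k arbitrary: i j)
  case 0
  then show ?case
    using A U by simp
next
  case (Suc k)
  have Ak: "A ^\<^sub>m k \<in> carrier_mat N N"
    using A by (simp add: pow_carrier_mat)
  have "(A ^\<^sub>m Suc k * U) $$ (i, j) = (A ^\<^sub>m k * (A * U)) $$ (i, j)"
    using assoc_mult_mat[OF Ak A U] by simp
  also have "\<dots> = (\<Sum>l<N. (A ^\<^sub>m k) $$ (i, l) * (U $$ (l, j) * d j))"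
    using A U Ak Suc.prems AU by (subst mult_mat_index[of _ N]) (auto intro!: sum.cong simp del: index_mult_mat)
  also have "\<dots> = (A ^\<^sub>m k * U) $$ (i, j) * d j"
    using A U Ak Suc.prems by (subst mult_mat_index[of _ N]) (auto simp: sum_distrib_right mult.assoc)
  finally show ?case
    using Suc by (simp del: index_mult_mat add: mult.assoc power_Suc2 del: power_Suc)
qed

lemma mat_exp_diagonalizable:
  assumes A: "A \<in> carrier_mat N N" and U: "U \<in> carrier_mat N N" and V: "V \<in> carrier_mat N N"
    and UV: "U * V = 1\<^sub>m N"
    and AU: "\<And>i j. i < N \<Longrightarrow> j < N \<Longrightarrow> (A * U) $$ (i, j) = U $$ (i, j) * d j"
    and ij: "i < N" "j < N"
  shows "mat_exp A $$ (i, j) = (\<Sum>a<N. U $$ (i, a) * exp (d a) * V $$ (a, j))"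
proof -
  have pow: "(A ^\<^sub>m k) $$ (i, j) = (\<Sum>a<N. U $$ (i, a) * d a ^ k * V $$ (a, j))" for k
  proof -
    have Ak: "A ^\<^sub>m k \<in> carrier_mat N N"
      using A by (simp add: pow_carrier_mat)
    have "A ^\<^sub>m k = A ^\<^sub>m k * U * V"
      using assoc_mult_mat[OF Ak U V] right_mult_one_mat[OF Ak] UV by simp
    then have "(A ^\<^sub>m k) $$ (i, j) = (A ^\<^sub>m k * U * V) $$ (i, j)"
      by simp
    also have "\<dots> = (\<Sum>a<N. U $$ (i, a) * d a ^ k * V $$ (a, j))"
      using A Ak U V ij pow_mat_eigencolumns[OF A U AU] mult_carrier_mat[OF Ak U]
      by (subst mult_mat_index[of _ N]) (auto intro!: sum.cong simp del: index_mult_mat)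
    finally show ?thesis .
  qed
  have "(\<lambda>k. \<Sum>a<N. U $$ (i, a) * (d a ^ k /\<^sub>R fact k) * V $$ (a, j))
      sums (\<Sum>a<N. U $$ (i, a) * exp (d a) * V $$ (a, j))"
    by (intro sums_sum sums_mult sums_mult2 exp_converges)
  then have "(\<lambda>k. (A ^\<^sub>m k) $$ (i, j) / fact k) sums (\<Sum>a<N. U $$ (i, a) * exp (d a) * V $$ (a, j))"
    by (simp add: pow sum_divide_distrib scaleR_conv_of_real field_simps)
  then show ?thesis
    using A ij by (simp add: mat_exp_def sums_unique[symmetric])
qed

text \<open>Cyclicity of the trace: the exponential contributes the diagonal weights \<open>exp (d a)\<close>, and the
  other factor enters only through its diagonal in the eigenbasis.\<close>

lemma mat_trace_exp_mult:
  assumes A: "A \<in> carrier_mat N N" and U: "U \<in> carrier_mat N N" and V: "V \<in> carrier_mat N N"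
    and T: "T \<in> carrier_mat N N"
    and UV: "U * V = 1\<^sub>m N"
    and AU: "\<And>i j. i < N \<Longrightarrow> j < N \<Longrightarrow> (A * U) $$ (i, j) = U $$ (i, j) * d j"
  shows "mat_trace (mat_exp A * T) = (\<Sum>a<N. exp (d a) * (V * T * U) $$ (a, a))"
proof -
  have E: "mat_exp A \<in> carrier_mat N N"
    using A by (auto simp: mat_exp_def)
  have VT: "V * T \<in> carrier_mat N N"
    using V T by simp
  have "mat_trace (mat_exp A * T) = (\<Sum>i<N. \<Sum>k<N. mat_exp A $$ (i, k) * T $$ (k, i))"
    using E T mult_mat_index[OF E T] by (auto simp: mat_trace_def intro!: sum.cong simp del: index_mult_mat(1))
  also have "\<dots> = (\<Sum>i<N. \<Sum>k<N. \<Sum>a<N. exp (d a) * (V $$ (a, k) * T $$ (k, i) * U $$ (i, a)))"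
    using mat_exp_diagonalizable[OF A U V UV AU]
    by (auto intro!: sum.cong simp: sum_distrib_right sum_distrib_left mult_ac)
  also have "\<dots> = (\<Sum>i<N. \<Sum>a<N. \<Sum>k<N. exp (d a) * (V $$ (a, k) * T $$ (k, i) * U $$ (i, a)))"
    by (intro sum.cong refl sum.swap)
  also have "\<dots> = (\<Sum>a<N. \<Sum>i<N. \<Sum>k<N. exp (d a) * (V $$ (a, k) * T $$ (k, i) * U $$ (i, a)))"
    by (rule sum.swap)
  also have "\<dots> = (\<Sum>a<N. exp (d a) * (V * T * U) $$ (a, a))"
    by (auto intro!: sum.cong simp del: index_mult_mat
        simp: mult_mat_index[OF VT U] mult_mat_index[OF V T] sum_distrib_left sum_distrib_right mult_ac)
  finally show ?thesis .
qed

section \<open>Diagonalization of the Hamiltonian\<close>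

text \<open>The columns are unnormalized eigenvectors of \<^const>\<open>sigma_x\<close> for the eigenvalues \<open>1\<close> and \<open>- 1\<close>;
  leaving out the factor \<open>1 / sqrt 2\<close> keeps all entries rational.\<close>

definition hadamard :: "complex mat" where
  "hadamard = Matrix.mat 2 2 (\<lambda>(i, j). if i = 1 \<and> j = 1 then - 1 else 1)"

text \<open>The bit \<open>False\<close> labels column \<open>0\<close> of \<^const>\<open>hadamard\<close>, hence the eigenvalue \<open>1\<close>.\<close>

definition spin :: "bool \<Rightarrow> real" where
  "spin b = (if b then - 1 else 1)"

definition sigma_z :: "complex mat" where
  "sigma_z = Matrix.mat 2 2 (\<lambda>(i, j). if i = j then (if i = 0 then 1 else - 1) else 0)"

text \<open>The energy of the antiferromagnetic Ising chain with open ends.\<close>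

definition ising_energy :: "bool list \<Rightarrow> real" where
  "ising_energy bs = (\<Sum>k<length bs - 1. spin (bs ! k) * spin (bs ! Suc k))"

definition hadamard_tensor :: "nat \<Rightarrow> complex mat" where
  "hadamard_tensor n = tensor_list (replicate n hadamard)"

definition hadamard_tensor_inv :: "nat \<Rightarrow> complex mat" where
  "hadamard_tensor_inv n = tensor_list (replicate n ((1 / 2) \<cdot>\<^sub>m hadamard))"

lemma carrier_qubit [simp]:
  "hadamard \<in> carrier_mat 2 2" "sigma_z \<in> carrier_mat 2 2" "sigma_x \<in> carrier_mat 2 2"
  by (rule carrier_matI; simp add: hadamard_def sigma_z_def sigma_x_def mat_of_rows_list_def)+

lemma sum_lessThan_2: "(\<Sum>i<2. f i) = f 0 + f (Suc 0)" for f :: "nat \<Rightarrow> 'a::comm_monoid_add"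
  by (simp add: numeral_2_eq_2)

lemma less_2_cases_nat: "i < (2::nat) \<longleftrightarrow> i = 0 \<or> i = Suc 0"
  by auto

lemma sigma_x_hadamard: "sigma_x * hadamard = hadamard * sigma_z"
proof (rule eq_matI)
  fix i j assume "i < dim_row (hadamard * sigma_z)" "j < dim_col (hadamard * sigma_z)"
  then have ij: "i < 2" "j < 2"
    using carrier_qubit by auto
  show "(sigma_x * hadamard) $$ (i, j) = (hadamard * sigma_z) $$ (i, j)"
    using ij unfolding mult_mat_index[OF carrier_qubit(3,1) ij] mult_mat_index[OF carrier_qubit(1,2) ij]
    by (auto simp: sum_lessThan_2 less_2_cases_nat hadamard_def sigma_z_def sigma_x_def mat_of_rows_list_def)
qed (simp_all add: hadamard_def sigma_z_def sigma_x_def mat_of_rows_list_def)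

lemma hadamard_inverse:
  "hadamard * ((1 / 2) \<cdot>\<^sub>m hadamard) = 1\<^sub>m 2" "((1 / 2) \<cdot>\<^sub>m hadamard) * hadamard = 1\<^sub>m 2"
proof -
  have c: "(1 / 2) \<cdot>\<^sub>m hadamard \<in> carrier_mat 2 2"
    by simp
  show "hadamard * ((1 / 2) \<cdot>\<^sub>m hadamard) = 1\<^sub>m 2"
  proof (rule eq_matI)
    fix i j assume "i < dim_row (1\<^sub>m 2 :: complex mat)" "j < dim_col (1\<^sub>m 2 :: complex mat)"
    then have ij: "i < 2" "j < 2"
      by auto
    show "(hadamard * ((1 / 2) \<cdot>\<^sub>m hadamard)) $$ (i, j) = 1\<^sub>m 2 $$ (i, j)"
      using ij unfolding mult_mat_index[OF carrier_qubit(1) c ij]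
      by (auto simp: sum_lessThan_2 less_2_cases_nat hadamard_def)
  qed (simp_all add: hadamard_def)
  show "((1 / 2) \<cdot>\<^sub>m hadamard) * hadamard = 1\<^sub>m 2"
  proof (rule eq_matI)
    fix i j assume "i < dim_row (1\<^sub>m 2 :: complex mat)" "j < dim_col (1\<^sub>m 2 :: complex mat)"
    then have ij: "i < 2" "j < 2"
      by auto
    show "(((1 / 2) \<cdot>\<^sub>m hadamard) * hadamard) $$ (i, j) = 1\<^sub>m 2 $$ (i, j)"
      using ij unfolding mult_mat_index[OF c carrier_qubit(1) ij]
      by (auto simp: sum_lessThan_2 less_2_cases_nat hadamard_def)
  qed (simp_all add: hadamard_def)
qed

lemma map2_replicate: "map2 f (replicate n x) (replicate n y) = replicate n (f x y)"
  by (induction n) simp_all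

lemma tensor_list_one: "tensor_list (replicate n (1\<^sub>m 2)) = 1\<^sub>m (2 ^ n)"
proof (induction n)
  case (Suc n)
  show ?case
  proof (rule eq_matI)
    fix i j :: nat
    assume "i < dim_row (1\<^sub>m (2 ^ Suc n) :: complex mat)" "j < dim_col (1\<^sub>m (2 ^ Suc n) :: complex mat)"
    then have ij: "i < 2 * 2 ^ n" "j < 2 * 2 ^ n"
      by simp_all
    have "i div 2 ^ n = j div 2 ^ n \<and> i mod 2 ^ n = j mod 2 ^ n \<longleftrightarrow> i = j"
      by (metis div_mult_mod_eq)
    then show "tensor_list (replicate (Suc n) (1\<^sub>m 2)) $$ (i, j) = 1\<^sub>m (2 ^ Suc n) $$ (i, j)"
      using ij index_bounds[OF ij(1)] index_bounds[OF ij(2)] by (auto simp: Suc index_kronecker)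
  qed (simp_all add: Suc)
qed simp

lemma hadamard_tensor_carrier [simp]:
  "hadamard_tensor n \<in> carrier_mat (2 ^ n) (2 ^ n)"
  "hadamard_tensor_inv n \<in> carrier_mat (2 ^ n) (2 ^ n)"
  using tensor_list_carrier[of "replicate n hadamard"]
    tensor_list_carrier[of "replicate n ((1 / 2) \<cdot>\<^sub>m hadamard)"]
  by (auto simp: hadamard_tensor_def hadamard_tensor_inv_def set_replicate_conv_if)

lemma hadamard_tensor_inverse:
  "hadamard_tensor n * hadamard_tensor_inv n = 1\<^sub>m (2 ^ n)"
  "hadamard_tensor_inv n * hadamard_tensor n = 1\<^sub>m (2 ^ n)"
  unfolding hadamard_tensor_def hadamard_tensor_inv_def
  by (subst tensor_list_mult; simp add: set_replicate_conv_if map2_replicate hadamard_inverse tensor_list_one)+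

definition bond :: "complex mat \<Rightarrow> nat \<Rightarrow> nat \<Rightarrow> complex mat" where
  "bond X n t = tensor_list (replicate t (1\<^sub>m 2) @ [X, X] @ replicate (n - t - 2) (1\<^sub>m 2))"

lemma bond_carrier:
  assumes "X \<in> carrier_mat 2 2" "t < n - 1"
  shows "bond X n t \<in> carrier_mat (2 ^ n) (2 ^ n)"
proof -
  have "length (replicate t (1\<^sub>m 2) @ [X, X] @ replicate (n - t - 2) (1\<^sub>m 2)) = n"
    using assms by simp
  then show ?thesis
    using tensor_list_carrier[of "replicate t (1\<^sub>m 2) @ [X, X] @ replicate (n - t - 2) (1\<^sub>m 2)"] assms
    by (simp only: bond_def) (simp add: set_replicate_conv_if)
qed

lemma hamiltonian_eq_bonds:
  "hamiltonian n = foldr (+) (map (bond sigma_x n) [0..<n - 1]) (0\<^sub>m (2 ^ n) (2 ^ n))"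
  by (simp add: hamiltonian_def bond_def interaction_def tensor_list_split_kronecker cong: map_cong)

lemma hamiltonian_carrier: "hamiltonian n \<in> carrier_mat (2 ^ n) (2 ^ n)"
  unfolding hamiltonian_eq_bonds
  by (rule foldr_add_mat) (auto intro!: bond_carrier[simplified] simp: bond_carrier)

text \<open>The relation \<open>sigma_x_hadamard\<close> holds factor by factor, since the remaining factors are identities
  and commute with \<^const>\<open>hadamard\<close>.\<close>

lemma bond_hadamard:
  assumes "t < n - 1"
  shows "bond sigma_x n t * hadamard_tensor n = hadamard_tensor n * bond sigma_z n t"
proof -
  define m where "m = n - t - 2"
  have n: "n = t + 2 + m"
    using assms by (simp add: m_def)
  have H: "hadamard_tensor n = tensor_list (replicate t hadamard @ [hadamard, hadamard] @ replicate m hadamard)"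
    unfolding hadamard_tensor_def n replicate_add append_assoc by (simp add: numeral_2_eq_2)
  show ?thesis
    unfolding H bond_def m_def[symmetric]
    by (subst tensor_list_mult; simp add: set_replicate_conv_if map2_replicate zip_append sigma_x_hadamard
         left_mult_one_mat[OF carrier_qubit(1)] right_mult_one_mat[OF carrier_qubit(1)])+
qed

lemma bond_sigma_z_diagonal:
  assumes t: "t < n - 1" and len: "length bs = n" "length cs = n"
  shows "bond sigma_z n t $$ (bits_index bs, bits_index cs)
    = (if bs = cs then of_real (spin (cs ! t) * spin (cs ! Suc t)) else 0)"
proof -
  define As where "As = replicate t (1\<^sub>m 2) @ [sigma_z, sigma_z] @ replicate (n - t - 2) (1\<^sub>m 2)"
  have As: "set As \<subseteq> carrier_mat 2 2" "length As = n"
    using t by (auto simp: As_def)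
  have nth: "As ! k = (if k = t \<or> k = Suc t then sigma_z else 1\<^sub>m 2)" if "k < n" for k
    using that t by (auto simp: As_def nth_append nth_Cons' less_Suc_eq)
  have z: "sigma_z $$ (of_bool b, of_bool c) = (if b = c then of_real (spin c) else 0)" for b c
    by (auto simp: sigma_z_def spin_def)
  have o: "(1\<^sub>m 2 :: complex mat) $$ (of_bool b, of_bool c) = (if b = c then 1 else 0)" for b c
    by auto
  have "bond sigma_z n t $$ (bits_index bs, bits_index cs)
      = (\<Prod>k<n. As ! k $$ (of_bool (bs ! k), of_bool (cs ! k)))"
    using tensor_list_index_bits[OF As(1)] len As(2) unfolding bond_def As_def[symmetric] by simp
  also have "\<dots> = (if bs = cs then of_real (spin (cs ! t) * spin (cs ! Suc t)) else 0)"
  proof (cases "bs = cs")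
    case True
    have "(\<Prod>k<n. As ! k $$ (of_bool (cs ! k), of_bool (cs ! k)))
        = (\<Prod>k<n. if k = t \<or> k = Suc t then of_real (spin (cs ! k)) else 1)"
      by (rule prod.cong) (auto simp: nth z o)
    also have "\<dots> = (\<Prod>k\<in>{t, Suc t}. of_real (spin (cs ! k)))"
      using t by (intro prod.mono_neutral_cong_right) auto
    finally show ?thesis
      using True by simp
  next
    case False
    then obtain k where k: "k < n" "bs ! k \<noteq> cs ! k"
      using len nth_equalityI[of bs cs] by auto
    \<comment> \<open>Each factor is diagonal, so a single differing bit annihilates the product.\<close>
    then have "As ! k $$ (of_bool (bs ! k), of_bool (cs ! k)) = 0"
      by (simp add: nth z o)
    then have "(\<Prod>k<n. As ! k $$ (of_bool (bs ! k), of_bool (cs ! k))) = 0"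
      using k by (intro prod_zero) (blast+)
    with False show ?thesis
      by simp
  qed
  finally show ?thesis .
qed

lemma sum_bits_index: "(\<Sum>a<2 ^ n. f a) = (\<Sum>bs | length bs = n. f (bits_index bs))"
  by (rule sum.reindex_bij_betw[OF bij_betw_bits_index, symmetric])

text \<open>All bond terms are diagonal in the same product basis, so the eigenvalues are the Ising energies of
  the bit strings.\<close>

lemma hamiltonian_hadamard:
  assumes i: "i < 2 ^ n" and len: "length cs = n"
  shows "(hamiltonian n * hadamard_tensor n) $$ (i, bits_index cs)
    = hadamard_tensor n $$ (i, bits_index cs) * of_real (ising_energy cs)"
proof -
  let ?N = "2 ^ n :: nat" and ?U = "hadamard_tensor n" and ?j = "bits_index cs"
  have j: "?j < ?N"
    using bits_index_less[of cs] len by simp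
  have U: "?U \<in> carrier_mat ?N ?N"
    by simp
  have B: "bond X n t \<in> carrier_mat ?N ?N" if "t \<in> {..<n - 1}" "X = sigma_x \<or> X = sigma_z" for t X
    using bond_carrier[of X t n] that by auto
  have "hamiltonian n $$ (i, k) = (\<Sum>t<n - 1. bond sigma_x n t $$ (i, k))" if "k < ?N" for k
  proof -
    have "hamiltonian n $$ (i, k) = (\<Sum>M\<leftarrow>map (bond sigma_x n) [0..<n - 1]. M $$ (i, k))"
      unfolding hamiltonian_eq_bonds using i that by (intro foldr_add_mat(2)) (auto simp: B)
    then show ?thesis
      by (simp add: interv_sum_list_conv_sum_set_nat comp_def atLeast0LessThan)
  qed
  then have "(hamiltonian n * ?U) $$ (i, ?j) = (\<Sum>k<?N. (\<Sum>t<n - 1. bond sigma_x n t $$ (i, k)) * ?U $$ (k, ?j))"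
    using mult_mat_index[OF hamiltonian_carrier U i j] by simp
  also have "\<dots> = (\<Sum>t<n - 1. \<Sum>k<?N. bond sigma_x n t $$ (i, k) * ?U $$ (k, ?j))"
    by (simp add: sum_distrib_right) (rule sum.swap)
  also have "\<dots> = (\<Sum>t<n - 1. (?U * bond sigma_z n t) $$ (i, ?j))"
    using mult_mat_index[OF B U i j] by (intro sum.cong refl) (simp add: bond_hadamard[symmetric])
  also have "\<dots> = (\<Sum>t<n - 1. ?U $$ (i, ?j) * of_real (spin (cs ! t) * spin (cs ! Suc t)))"
  proof (rule sum.cong[OF refl])
    fix t assume t: "t \<in> {..<n - 1}"
    have "(?U * bond sigma_z n t) $$ (i, ?j)
        = (\<Sum>bs | length bs = n. ?U $$ (i, bits_index bs) * bond sigma_z n t $$ (bits_index bs, ?j))"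
      using mult_mat_index[OF U B[OF t] i j] by (simp add: sum_bits_index)
    also have "\<dots> = (\<Sum>bs | length bs = n. if bs = cs then ?U $$ (i, ?j) * of_real (spin (cs ! t) * spin (cs ! Suc t)) else 0)"
      using t len by (intro sum.cong) (auto simp: bond_sigma_z_diagonal)
    also have "\<dots> = ?U $$ (i, ?j) * of_real (spin (cs ! t) * spin (cs ! Suc t))"
      using len finite_lists_length_eq[of "UNIV :: bool set" n] by simp
    finally show "(?U * bond sigma_z n t) $$ (i, ?j) = ?U $$ (i, ?j) * of_real (spin (cs ! t) * spin (cs ! Suc t))" .
  qed
  finally show ?thesis
    by (simp add: ising_energy_def len sum_distrib_left)
qed

section \<open>The Gibbs weights and their zero-temperature limit\<close>

text \<open>The probability of the outcome \<open>j\<close> when the observable is measured in the eigenstate of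
  \<^const>\<open>sigma_x\<close> labelled by \<open>b\<close>; see \<open>hadamard_conj_projection\<close>.\<close>

definition local_prob :: "real \<Rightarrow> bool \<Rightarrow> nat \<Rightarrow> real" where
  "local_prob \<theta> b j = (1 + spin b * (if j = 1 then 1 else - 1) * sin (2 * \<theta>)) / 2"

lemma observable_projection_carrier [simp]: "observable_projection \<theta> j \<in> carrier_mat 2 2"
  by (rule carrier_matI) (simp_all add: observable_projection_def line_projection_def observable_eigenvector_def)

lemma observable_projection_index:
  assumes "j \<in> {1, 2}" "i < 2" "k < 2"
  shows "observable_projection \<theta> j $$ (i, k)
    = vec_index (observable_eigenvector \<theta> j) i * vec_index (observable_eigenvector \<theta> j) k"
proof -
  have "observable_eigenvector \<theta> j \<bullet>c observable_eigenvector \<theta> j = 1"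
    using assms(1) observable_eigenvectors(3,4)[of \<theta>] by auto
  moreover have "cnj (vec_index (observable_eigenvector \<theta> j) k) = vec_index (observable_eigenvector \<theta> j) k"
    using assms(3) by (auto simp: observable_eigenvector_def less_2_cases_nat)
  moreover have "dim_vec (observable_eigenvector \<theta> j) = 2"
    by (simp add: observable_eigenvector_def)
  ultimately show ?thesis
    using assms by (simp add: observable_projection_def line_projection_def)
qed

lemma hadamard_index:
  "hadamard $$ (0, 0) = 1" "hadamard $$ (0, Suc 0) = 1"
  "hadamard $$ (Suc 0, 0) = 1" "hadamard $$ (Suc 0, Suc 0) = - 1"
  "dim_row hadamard = 2" "dim_col hadamard = 2"
  by (simp_all add: hadamard_def)

lemma hadamard_conj_projection:
  assumes "j \<in> {1, 2}"
  shows "((1 / 2) \<cdot>\<^sub>m hadamard * observable_projection \<theta> j * hadamard) $$ (of_bool b, of_bool b)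
    = of_real (local_prob \<theta> b j)"
proof -
  have c: "(1 / 2) \<cdot>\<^sub>m hadamard \<in> carrier_mat 2 2"
    by simp
  have c': "(1 / 2) \<cdot>\<^sub>m hadamard * observable_projection \<theta> j \<in> carrier_mat 2 2"
    by (rule mult_carrier_mat[OF c]) simp
  have b: "of_bool b < (2::nat)"
    by (cases b) auto
  have sd: "sin (\<theta> * 2) = cos \<theta> * (sin \<theta> * 2)"
    using sin_double[of \<theta>] by (simp add: mult_ac)
  have cs: "cos \<theta> * cos \<theta> = 1 - sin \<theta> * sin \<theta>"
    using cos_squared_eq[of \<theta>] by (simp add: power2_eq_square)
  show ?thesis
    using assms unfolding mult_mat_index[OF c' carrier_qubit(1) b b]
    by (cases b) (auto simp: sum_lessThan_2 mult_mat_index[OF c observable_projection_carrier]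
        observable_projection_index hadamard_index observable_eigenvector_def local_prob_def spin_def
        complex_eq_iff field_simps cs sd)
qed

text \<open>A basis state is a product state, so the outcomes at different sites are independent in it.\<close>

lemma hadamard_conj_tensor_projection:
  assumes "set js \<subseteq> {1, 2}" "length bs = length js"
  defines "n \<equiv> length js"
  shows "(hadamard_tensor_inv n * tensor_list (map (observable_projection \<theta>) js) * hadamard_tensor n)
      $$ (bits_index bs, bits_index bs)
    = of_real (\<Prod>k<n. local_prob \<theta> (bs ! k) (js ! k))"
proof -
  define As where "As = map (\<lambda>j. (1 / 2) \<cdot>\<^sub>m hadamard * observable_projection \<theta> j * hadamard) js"
  have c: "(1 / 2) \<cdot>\<^sub>m hadamard \<in> carrier_mat 2 2"
    by simp
  have c': "(1 / 2) \<cdot>\<^sub>m hadamard * observable_projection \<theta> j \<in> carrier_mat 2 2" for j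
    by (rule mult_carrier_mat[OF c]) simp
  have As: "set As \<subseteq> carrier_mat 2 2" "length As = n"
    using mult_carrier_mat[OF c' carrier_qubit(1)] by (auto simp: As_def n_def)
  have "hadamard_tensor_inv n * tensor_list (map (observable_projection \<theta>) js)
      = tensor_list (map2 (*) (replicate n ((1 / 2) \<cdot>\<^sub>m hadamard)) (map (observable_projection \<theta>) js))"
    unfolding hadamard_tensor_inv_def
    by (rule tensor_list_mult) (auto simp: n_def)
  also have "map2 (*) (replicate n ((1 / 2) \<cdot>\<^sub>m hadamard)) (map (observable_projection \<theta>) js)
      = map (\<lambda>j. (1 / 2) \<cdot>\<^sub>m hadamard * observable_projection \<theta> j) js"
    by (rule nth_equalityI) (auto simp: n_def)
  finally have "hadamard_tensor_inv n * tensor_list (map (observable_projection \<theta>) js) * hadamard_tensor n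
      = tensor_list (map2 (*) (map (\<lambda>j. (1 / 2) \<cdot>\<^sub>m hadamard * observable_projection \<theta> j) js) (replicate n hadamard))"
    unfolding hadamard_tensor_def using c'
    by (subst tensor_list_mult[symmetric]) (auto simp: n_def set_replicate_conv_if)
  also have "map2 (*) (map (\<lambda>j. (1 / 2) \<cdot>\<^sub>m hadamard * observable_projection \<theta> j) js) (replicate n hadamard) = As"
    by (rule nth_equalityI) (auto simp: n_def As_def)
  finally show ?thesis
    using tensor_list_index_bits[OF As(1), of bs bs] assms(1,2) As(2)
    by (auto simp: As_def n_def hadamard_conj_projection subset_iff of_real_prod intro!: prod.cong)
qed

lemma mat_trace_exp_hamiltonian:
  assumes T: "T \<in> carrier_mat (2 ^ n) (2 ^ n)"
  shows "mat_trace (mat_exp (of_real (- \<beta>) \<cdot>\<^sub>m hamiltonian n) * T)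
    = (\<Sum>bs | length bs = n. of_real (exp (- \<beta> * ising_energy bs)) *
        (hadamard_tensor_inv n * T * hadamard_tensor n) $$ (bits_index bs, bits_index bs))"
proof -
  let ?N = "2 ^ n :: nat" and ?c = "of_real (- \<beta>) :: complex"
  \<comment> \<open>The columns are numbered by indices, so the energy of a bit string is pulled back along the numbering.\<close>
  define d :: "nat \<Rightarrow> complex" where
    "d a = of_real (- \<beta> * ising_energy (the_inv_into {bs. length bs = n} bits_index a))" for a
  have d: "d (bits_index bs) = of_real (- \<beta> * ising_energy bs)" if "length bs = n" for bs
    using that bij_betw_bits_index[of n] by (simp add: d_def bij_betw_def the_inv_into_f_f)
  have AU: "(?c \<cdot>\<^sub>m hamiltonian n * hadamard_tensor n) $$ (i, j) = hadamard_tensor n $$ (i, j) * d j"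
    if ij: "i < ?N" "j < ?N" for i j
  proof -
    obtain cs where cs: "length cs = n" "j = bits_index cs"
      using ij(2) bij_betw_bits_index[of n] by (force simp: bij_betw_def)
    have "?c \<cdot>\<^sub>m hamiltonian n * hadamard_tensor n = ?c \<cdot>\<^sub>m (hamiltonian n * hadamard_tensor n)"
      by (rule mult_smult_assoc_mat[OF hamiltonian_carrier hadamard_tensor_carrier(1)])
    then show ?thesis
      using ij hamiltonian_hadamard[OF ij(1) cs(1)]
        carrier_matD[OF hamiltonian_carrier[of n]] carrier_matD[OF hadamard_tensor_carrier(1)[of n]]
      by (simp add: cs d del: index_mult_mat(1))
  qed
  show ?thesis
    using mat_trace_exp_mult[OF _ hadamard_tensor_carrier T hadamard_tensor_inverse(1) AU]
      hamiltonian_carrier[of n]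
    by (simp add: sum_bits_index d exp_of_real del: of_real_mult of_real_minus exp_of_real flip: exp_of_real)
qed

text \<open>The quantum expectation is a classical Boltzmann average over bit strings, since the Hamiltonian is
  diagonal in a product basis.\<close>

lemma gibbs_weight_eq:
  assumes "set js \<subseteq> {1, 2}"
  defines "n \<equiv> length js"
  shows "gibbs_weight \<theta> \<beta> js = of_real
    ((\<Sum>bs | length bs = n. exp (- \<beta> * ising_energy bs) * (\<Prod>k<n. local_prob \<theta> (bs ! k) (js ! k))) /
     (\<Sum>bs | length bs = n. exp (- \<beta> * ising_energy bs)))"
proof -
  let ?T = "tensor_list (map (observable_projection \<theta>) js)"
    and ?E = "mat_exp (of_real (- \<beta>) \<cdot>\<^sub>m hamiltonian n)"
  have T: "?T \<in> carrier_mat (2 ^ n) (2 ^ n)"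
    using tensor_list_carrier[of "map (observable_projection \<theta>) js"] by (simp add: n_def image_subset_iff)
  have "?E \<in> carrier_mat (2 ^ n) (2 ^ n)"
    using hamiltonian_carrier[of n] by (auto simp: mat_exp_def)
  then have "mat_trace ?E = mat_trace (?E * 1\<^sub>m (2 ^ n))"
    by simp
  also have "\<dots> = of_real (\<Sum>bs | length bs = n. exp (- \<beta> * ising_energy bs))"
    using bits_index_less
    by (subst mat_trace_exp_hamiltonian)
      (auto intro!: sum.cong simp: hadamard_tensor_inverse right_mult_one_mat[OF hadamard_tensor_carrier(2)])
  finally have den: "mat_trace ?E = of_real (\<Sum>bs | length bs = n. exp (- \<beta> * ising_energy bs))" .
  have "mat_trace (?E * ?T) = of_real (\<Sum>bs | length bs = n.
      exp (- \<beta> * ising_energy bs) * (\<Prod>k<n. local_prob \<theta> (bs ! k) (js ! k)))"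
    using mat_trace_exp_hamiltonian[OF T] hadamard_conj_tensor_projection[OF assms(1)]
    by (simp add: n_def)
  with den show ?thesis
    by (simp add: gibbs_weight_def n_def)
qed

text \<open>Multiplying numerator and denominator by \<open>exp (\<beta> * m)\<close> makes the weights of the minimizers of \<open>E\<close>
  equal to \<open>1\<close> and all the other weights tend to \<open>0\<close>.\<close>

lemma gibbs_average_tendsto:
  fixes E w :: "'a \<Rightarrow> real"
  assumes S: "finite S" and min: "\<And>a. a \<in> S \<Longrightarrow> m \<le> E a" and ne: "{a \<in> S. E a = m} \<noteq> {}"
  shows "((\<lambda>\<beta>. (\<Sum>a\<in>S. exp (- \<beta> * E a) * w a) / (\<Sum>a\<in>S. exp (- \<beta> * E a)))
    \<longlongrightarrow> (\<Sum>a | a \<in> S \<and> E a = m. w a) / card {a \<in> S. E a = m}) at_top"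
proof -
  have lim: "((\<lambda>\<beta>. \<Sum>a\<in>S. exp (- \<beta> * (E a - m)) * v a) \<longlongrightarrow> (\<Sum>a | a \<in> S \<and> E a = m. v a)) at_top"
    for v :: "'a \<Rightarrow> real"
  proof -
    have "((\<lambda>\<beta>. exp (- \<beta> * (E a - m)) * v a) \<longlongrightarrow> (if E a = m then 1 else 0) * v a) at_top"
      if a: "a \<in> S" for a
    proof (cases "E a = m")
      case False
      with min[OF a] have "0 < E a - m"
        by simp
      then have "((\<lambda>\<beta>. exp (- \<beta> * (E a - m))) \<longlongrightarrow> 0) at_top"
        by real_asymp
      with False show ?thesis
        by (auto intro: tendsto_mult_left_zero)
    qed simp
    then have "((\<lambda>\<beta>. \<Sum>a\<in>S. exp (- \<beta> * (E a - m)) * v a)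
        \<longlongrightarrow> (\<Sum>a\<in>S. (if E a = m then 1 else 0) * v a)) at_top"
      by (rule tendsto_sum)
    also have "(\<Sum>a\<in>S. (if E a = m then 1 else 0) * v a) = (\<Sum>a | a \<in> S \<and> E a = m. v a)"
      using S by (intro sum.mono_neutral_cong_right) auto
    finally show ?thesis .
  qed
  have "(\<Sum>a\<in>S. exp (- \<beta> * E a) * w a) / (\<Sum>a\<in>S. exp (- \<beta> * E a))
      = (\<Sum>a\<in>S. exp (- \<beta> * (E a - m)) * w a) / (\<Sum>a\<in>S. exp (- \<beta> * (E a - m)) * 1)" for \<beta>
  proof -
    have "exp (- \<beta> * (E a - m)) = exp (\<beta> * m) * exp (- \<beta> * E a)" for a
      by (simp add: exp_add[symmetric] algebra_simps)
    then show ?thesis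
      by (simp add: mult.assoc sum_distrib_left[symmetric])
  qed
  moreover have "card {a \<in> S. E a = m} \<noteq> 0"
    using S ne by simp
  ultimately show ?thesis
    using tendsto_divide[OF lim[of w] lim[of "\<lambda>_. 1"]] by simp
qed

definition alternating :: "nat \<Rightarrow> bool \<Rightarrow> bool list" where
  "alternating n c = map (\<lambda>k. even k \<longleftrightarrow> c) [0..<n]"

lemma length_alternating [simp]: "length (alternating n c) = n"
  by (simp add: alternating_def)

text \<open>Each bond contributes at least \<open>- 1\<close>, with equality exactly when its two spins differ; all bonds
  attain the minimum together precisely on the two alternating strings.\<close>

lemma
  assumes n: "2 \<le> length bs"
  shows ising_energy_ge: "1 - real (length bs) \<le> ising_energy bs"
    and ising_energy_minimal_iff: "ising_energy bs = 1 - real (length bs)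
      \<longleftrightarrow> bs \<in> {alternating (length bs) True, alternating (length bs) False}"
proof -
  let ?n = "length bs"
  have pair: "0 \<le> spin b * spin c + 1" "spin b * spin c + 1 = 0 \<longleftrightarrow> b \<noteq> c" for b c
    by (auto simp: spin_def)
  have E: "ising_energy bs + real (?n - 1) = (\<Sum>k<?n - 1. spin (bs ! k) * spin (bs ! Suc k) + 1)"
    by (simp add: ising_energy_def sum.distrib)
  also have "\<dots> \<ge> 0"
    by (intro sum_nonneg) (simp add: pair)
  finally show "1 - real ?n \<le> ising_energy bs"
    using n by (simp add: of_nat_diff)
  have "ising_energy bs = 1 - real ?n \<longleftrightarrow> (\<Sum>k<?n - 1. spin (bs ! k) * spin (bs ! Suc k) + 1) = 0"
    unfolding E[symmetric] using n by (auto simp: of_nat_diff)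
  also have "\<dots> \<longleftrightarrow> (\<forall>k<?n - 1. bs ! k \<noteq> bs ! Suc k)"
    by (subst sum_nonneg_eq_0_iff) (auto simp: pair)
  also have "\<dots> \<longleftrightarrow> bs \<in> {alternating ?n True, alternating ?n False}"
  proof
    assume *: "\<forall>k<?n - 1. bs ! k \<noteq> bs ! Suc k"
    have "k < ?n \<Longrightarrow> bs ! k = (even k \<longleftrightarrow> bs ! 0)" for k
    proof (induction k)
      case (Suc k)
      then have "k < ?n - 1" "k < ?n"
        by auto
      then show ?case
        using * Suc.IH by (metis even_Suc)
    qed simp
    then have "bs = alternating ?n (bs ! 0)"
      by (intro nth_equalityI) (auto simp: alternating_def)
    then show "bs \<in> {alternating ?n True, alternating ?n False}"
      by (cases "bs ! 0") auto
  next
    assume "bs \<in> {alternating ?n True, alternating ?n False}"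
    then obtain c where c: "bs = alternating ?n c"
      by blast
    have "bs ! k = (even k \<longleftrightarrow> c)" if "k < ?n" for k
      by (subst c) (simp add: alternating_def that)
    then show "\<forall>k<?n - 1. bs ! k \<noteq> bs ! Suc k"
      by auto
  qed
  finally show "ising_energy bs = 1 - real ?n \<longleftrightarrow> bs \<in> {alternating ?n True, alternating ?n False}" .
qed

text \<open>Only the two alternating ground states survive, with equal weights.\<close>

lemma ground_weight_eq:
  assumes js: "set js \<subseteq> {1, 2}" and n: "2 \<le> length js"
  shows "ground_weight \<theta> js = of_real
    (((\<Prod>k<length js. local_prob \<theta> (even k) (js ! k)) + (\<Prod>k<length js. local_prob \<theta> (odd k) (js ! k))) / 2)"
proof -
  let ?n = "length js"
  let ?w = "\<lambda>bs. \<Prod>k<?n. local_prob \<theta> (bs ! k) (js ! k)"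
  have G: "{bs \<in> {bs. length bs = ?n}. ising_energy bs = 1 - real ?n}
      = {alternating ?n True, alternating ?n False}"
  proof (rule Set.set_eqI)
    fix bs
    show "bs \<in> {bs \<in> {bs. length bs = ?n}. ising_energy bs = 1 - real ?n}
        \<longleftrightarrow> bs \<in> {alternating ?n True, alternating ?n False}"
    proof (cases "length bs = ?n")
      case True
      then show ?thesis
        using ising_energy_minimal_iff[of bs] n by simp
    qed auto
  qed
  have "alternating ?n c ! 0 = c" for c
  proof -
    have "0 < length [0..<?n]"
      using n by (simp only: length_upt)
    then show ?thesis
      unfolding alternating_def by (subst nth_map) auto
  qed
  then have "alternating ?n True ! 0 \<noteq> alternating ?n False ! 0"
    by simp
  then have ne: "alternating ?n True \<noteq> alternating ?n False"
    by metis
  have fin: "finite {bs :: bool list. length bs = ?n}"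
    using finite_lists_length_eq[of "UNIV :: bool set" ?n] by simp
  have "((\<lambda>\<beta>. gibbs_weight \<theta> \<beta> js) \<longlongrightarrow>
      of_real ((\<Sum>bs | bs \<in> {bs. length bs = ?n} \<and> ising_energy bs = 1 - real ?n. ?w bs)
        / card {bs \<in> {bs. length bs = ?n}. ising_energy bs = 1 - real ?n})) at_top"
    unfolding gibbs_weight_eq[OF js]
  proof (rule tendsto_of_real, rule gibbs_average_tendsto[OF fin])
    fix bs :: "bool list" assume "bs \<in> {bs. length bs = ?n}"
    then show "1 - real ?n \<le> ising_energy bs"
      using ising_energy_ge[of bs] n by simp
  qed (unfold G, rule insert_not_empty)
  then have "ground_weight \<theta> js = of_real ((\<Sum>bs\<in>{alternating ?n True, alternating ?n False}. ?w bs)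
        / card {alternating ?n True, alternating ?n False})"
    unfolding ground_weight_def G by (rule tendsto_Lim[OF trivial_limit_at_top_linorder])
  also have "\<dots> = of_real ((?w (alternating ?n True) + ?w (alternating ?n False)) / 2)"
    using ne by simp
  also have "?w (alternating ?n True) = (\<Prod>k<?n. local_prob \<theta> (even k) (js ! k))"
    by (rule prod.cong) (simp_all add: alternating_def)
  also have "?w (alternating ?n False) = (\<Prod>k<?n. local_prob \<theta> (odd k) (js ! k))"
    by (rule prod.cong) (simp_all add: alternating_def)
  finally show ?thesis .
qed

section \<open>Staggered product measures\<close>

lemma local_prob_nonneg: "0 \<le> local_prob \<theta> b j"
proof -
  have "0 \<le> 1 + sin (2 * \<theta>)" "0 \<le> 1 - sin (2 * \<theta>)"
    using sin_ge_minus_one[of "2 * \<theta>"] sin_le_one[of "2 * \<theta>"] by linarith+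
  then show ?thesis
    by (auto simp: local_prob_def spin_def)
qed

lemma local_prob_sum: "local_prob \<theta> b 1 + local_prob \<theta> b 2 = 1"
  by (simp add: local_prob_def field_simps)

lemma local_prob_Not: "local_prob \<theta> (\<not> b) j = 1 - local_prob \<theta> b j"
  by (simp add: local_prob_def spin_def field_simps)

definition site_measure :: "real \<Rightarrow> bool \<Rightarrow> nat measure" where
  "site_measure \<theta> b = point_measure {1, 2} (\<lambda>j. ennreal (local_prob \<theta> b j))"

lemma sets_site_measure [simp]: "sets (site_measure \<theta> b) = Pow {1, 2}"
  by (simp add: site_measure_def sets_point_measure)

lemma space_site_measure [simp]: "space (site_measure \<theta> b) = {1, 2}"
  by (simp add: site_measure_def space_point_measure)

lemma prob_space_site_measure: "prob_space (site_measure \<theta> b)"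
proof (rule prob_spaceI)
  have "emeasure (site_measure \<theta> b) (space (site_measure \<theta> b))
      = ennreal (local_prob \<theta> b 1) + ennreal (local_prob \<theta> b 2)"
    by (simp add: site_measure_def space_point_measure emeasure_point_measure_finite)
  also have "\<dots> = 1"
    using local_prob_sum[of \<theta> b] by (simp add: ennreal_plus[symmetric] local_prob_nonneg del: ennreal_plus)
  finally show "emeasure (site_measure \<theta> b) (space (site_measure \<theta> b)) = 1" .
qed

lemma measure_site_measure: "j \<in> {1, 2} \<Longrightarrow> measure (site_measure \<theta> b) {j} = local_prob \<theta> b j"
  unfolding site_measure_def measure_def
  by (subst emeasure_point_measure_finite) (auto simp: local_prob_nonneg)

text \<open>The law of the outcomes in one of the two ground states: independent, with the two one-site
  distributions alternating. The flag \<open>c\<close> is the label at site \<open>0\<close>.\<close>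

definition staggered :: "real \<Rightarrow> bool \<Rightarrow> (nat \<Rightarrow> nat) measure" where
  "staggered \<theta> c = Pi\<^sub>M UNIV (\<lambda>k. site_measure \<theta> (even k \<longleftrightarrow> c))"

lemma sets_staggered [simp, measurable_cong]: "sets (staggered \<theta> c) = sets Omega_algebra"
  unfolding staggered_def Omega_algebra_def by (rule sets_PiM_cong) simp_all

lemma space_staggered [simp]: "space (staggered \<theta> c) = Omega"
  using sets_eq_imp_space_eq[OF sets_staggered] by (simp add: space_Omega_algebra)

lemma prob_space_staggered: "prob_space (staggered \<theta> c)"
  unfolding staggered_def by (intro prob_space_PiM prob_space_site_measure)

interpretation site: prob_space "site_measure \<theta> b" for \<theta> b
  by (rule prob_space_site_measure)

interpretation stag: prob_space "staggered \<theta> c" for \<theta> c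
  by (rule prob_space_staggered)

lemma measure_staggered_coordinates:
  assumes "finite K" "\<And>k. k \<in> K \<Longrightarrow> s k \<in> {1, 2}"
  shows "{x \<in> Omega. \<forall>k\<in>K. x k = s k} \<in> sets Omega_algebra" (is "?A \<in> _")
    and "measure (staggered \<theta> c) {x \<in> Omega. \<forall>k\<in>K. x k = s k} = (\<Prod>k\<in>K. local_prob \<theta> (even k \<longleftrightarrow> c) (s k))"
proof -
  interpret product_prob_space "\<lambda>k. site_measure \<theta> (even k \<longleftrightarrow> c)" UNIV
    by unfold_locales
  \<comment> \<open>The constraint concerns finitely many coordinates, so this is a cylinder of the product measure.\<close>
  have eq: "?A = prod_emb UNIV (\<lambda>k. site_measure \<theta> (even k \<longleftrightarrow> c)) K (\<Pi>\<^sub>E k\<in>K. {s k})"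
    using assms(2) by (auto simp: prod_emb_def Omega_def PiE_iff extensional_def)
  have "?A \<in> sets (staggered \<theta> c)"
    unfolding eq staggered_def using assms by (intro sets_PiM_I) auto
  then show "?A \<in> sets Omega_algebra"
    by simp
  show "measure (staggered \<theta> c) ?A = (\<Prod>k\<in>K. local_prob \<theta> (even k \<longleftrightarrow> c) (s k))"
    unfolding eq staggered_def using assms
    by (subst measure_PiM_emb) (auto simp: measure_site_measure[simplified] intro!: prod.cong)
qed

lemma
  assumes "set js \<subseteq> {1, 2}"
  shows cylinder_in_sets: "cylinder js \<in> sets Omega_algebra"
    and measure_staggered_cylinder: "measure (staggered \<theta> c) (cylinder js)
      = (\<Prod>k<length js. local_prob \<theta> (even k \<longleftrightarrow> c) (js ! k))"
proof -
  have eq: "cylinder js = {x \<in> Omega. \<forall>k\<in>{..<length js}. x k = js ! k}"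
    by (simp add: cylinder_def Ball_def)
  have s: "js ! k \<in> {1, 2}" if "k \<in> {..<length js}" for k
    using assms nth_mem[of k js] that by blast
  show "cylinder js \<in> sets Omega_algebra"
    unfolding eq by (rule measure_staggered_coordinates(1)[OF finite_lessThan s])
  show "measure (staggered \<theta> c) (cylinder js) = (\<Prod>k<length js. local_prob \<theta> (even k \<longleftrightarrow> c) (js ! k))"
    unfolding eq by (rule measure_staggered_coordinates(2)[OF finite_lessThan s])
qed

text \<open>Agreement on long cylinders extends to all measurable sets: a rectangle with finite base is a
  finite disjoint union of cylinders of any sufficiently large length, and rectangles form an
  intersection-stable generator.\<close>

lemma measure_eq_staggered_average:
  assumes "prob_space \<mu>" and sets: "sets \<mu> = sets Omega_algebra"
    and cyl: "\<And>js. 2 \<le> length js \<Longrightarrow> set js \<subseteq> {1, 2} \<Longrightarrow> measure \<mu> (cylinder js) =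
      (measure (staggered \<theta> True) (cylinder js) + measure (staggered \<theta> False) (cylinder js)) / 2"
    and A: "A \<in> sets Omega_algebra"
  shows "measure \<mu> A = (measure (staggered \<theta> True) A + measure (staggered \<theta> False) A) / 2"
proof -
  interpret prob_space \<mu> by fact
  have space: "space \<mu> = Omega"
    using sets_eq_imp_space_eq[OF sets] by (simp add: space_Omega_algebra)
  let ?M = "\<lambda>_ :: nat. count_space {1, 2 :: nat}"
  have Om: "(\<Pi>\<^sub>E i\<in>UNIV. space (?M i)) = Omega"
    by (auto simp: Omega_def PiE_iff)
  have gen: "sigma_sets Omega (prod_algebra UNIV ?M) = sets Omega_algebra"
    using sets_PiM[of UNIV ?M] unfolding Om Omega_algebra_def by simp
  have A': "A \<in> sigma_sets Omega (prod_algebra UNIV ?M)"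
    using A gen by simp
  have closed: "prod_algebra UNIV ?M \<subseteq> Pow Omega"
    using prod_algebra_sets_into_space[of UNIV ?M] unfolding Om .
  show ?thesis
    using Int_stable_prod_algebra closed A'
  proof (induction rule: sigma_sets_induct_disjoint)
    case (basic A)
    then obtain J E where A: "A = prod_emb UNIV ?M J (\<Pi>\<^sub>E j\<in>J. E j)" and J: "finite J"
      by (elim prod_algebraE) auto
    \<comment> \<open>The length exceeds every index in the base and is at least 2, where the hypothesis applies.\<close>
    obtain N where N: "2 \<le> N" "J \<subseteq> {..<N}"
    proof -
      obtain m where "J \<subseteq> {..<m}"
        using J finite_nat_iff_bounded by blast
      then have "J \<subseteq> {..<max 2 m}"
        by auto
      then show ?thesis
        using that[of "max 2 m"] by simp
    qed
    define L where "L = {js. set js \<subseteq> {1, 2} \<and> length js = N \<and> (\<forall>k\<in>J. js ! k \<in> E k)}"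
    have "finite L"
      by (rule finite_subset[OF _ finite_lists_length_eq[of "{1, 2 :: nat}" N]]) (auto simp: L_def)
    have "A = (\<Union>js\<in>L. cylinder js)"
    proof (intro equalityI subsetI)
      fix x assume x: "x \<in> A"
      then have "x \<in> Omega" "\<And>k. k \<in> J \<Longrightarrow> x k \<in> E k"
        by (auto simp: A prod_emb_def Omega_def PiE_iff)
      then have "map x [0..<N] \<in> L" "x \<in> cylinder (map x [0..<N])"
        using N by (auto simp: L_def cylinder_def Omega_def)
      then show "x \<in> (\<Union>js\<in>L. cylinder js)"
        by blast
    next
      fix x assume "x \<in> (\<Union>js\<in>L. cylinder js)"
      then obtain js where js: "js \<in> L" "x \<in> cylinder js"
        by blast
      then have "x k \<in> E k" if "k \<in> J" for k
        using that N by (auto simp: L_def cylinder_def)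
      with js show "x \<in> A"
        by (auto simp: A prod_emb_def PiE_iff cylinder_def Omega_def)
    qed
    moreover have "disjoint_family_on cylinder L"
      unfolding disjoint_family_on_def
    proof (intro ballI impI)
      fix js ks assume *: "js \<in> L" "ks \<in> L" "js \<noteq> ks"
      have "js = ks" if "x \<in> cylinder js" "x \<in> cylinder ks" for x
        using * that by (intro nth_equalityI) (auto simp: L_def cylinder_def)
      with * show "cylinder js \<inter> cylinder ks = {}"
        by blast
    qed
    moreover have "cylinder ` L \<subseteq> sets Omega_algebra"
      by (auto simp: L_def intro!: cylinder_in_sets)
    ultimately have "measure \<nu> A = (\<Sum>js\<in>L. measure \<nu> (cylinder js))"
      if "prob_space \<nu>" "sets \<nu> = sets Omega_algebra" for \<nu> :: "(nat \<Rightarrow> nat) measure"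
      using that \<open>finite L\<close> prob_space.finite_measure[OF that(1)]
      by (simp add: finite_measure.finite_measure_finite_Union)
    note additive = this
    have "measure \<mu> (cylinder js) = (measure (staggered \<theta> True) (cylinder js) +
        measure (staggered \<theta> False) (cylinder js)) / 2" if "js \<in> L" for js
      using that N by (intro cyl) (auto simp: L_def)
    then show ?case
      unfolding additive[OF assms(1) sets] additive[OF prob_space_staggered sets_staggered]
      by (simp only: sum.distrib[symmetric] sum_divide_distrib cong: sum.cong)
  next
    case empty
    show ?case by simp
  next
    case (compl A)
    then have "A \<in> sets Omega_algebra"
      using gen by simp
    then have \<mu>: "measure \<mu> (Omega - A) = 1 - measure \<mu> A"
      and staggered: "measure (staggered \<theta> c) (Omega - A) = 1 - measure (staggered \<theta> c) A" for c
      using prob_compl[of A] stag.prob_compl[of A \<theta> c] by (simp_all add: space sets)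
    show ?case
      unfolding \<mu> staggered compl.IH by (simp add: field_simps)
  next
    case (union A)
    then have "range A \<subseteq> sets Omega_algebra"
      using gen by auto
    then have \<mu>: "(\<lambda>i. measure \<mu> (A i)) sums measure \<mu> (\<Union>i. A i)"
      and staggered: "(\<lambda>i. measure (staggered \<theta> c) (A i)) sums measure (staggered \<theta> c) (\<Union>i. A i)" for c
      using union finite_measure_UNION[of A] stag.finite_measure_UNION[of A] by (simp_all add: sets)
    have "(\<lambda>i. measure \<mu> (A i)) sums
       ((measure (staggered \<theta> True) (\<Union>i. A i) + measure (staggered \<theta> False) (\<Union>i. A i)) / 2)"
      unfolding union.IH by (intro sums_divide sums_add staggered)
    with \<mu> show ?case
      by (rule sums_unique2)
  qed
qed

lemma measurable_coordinate: "(\<lambda>x. x k) \<in> measurable Omega_algebra (count_space {1, 2})"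
  unfolding Omega_algebra_def by (rule measurable_component_singleton) simp

lemma measurable_shift_map: "shift_map \<in> measurable Omega_algebra Omega_algebra"
proof -
  have "(\<lambda>x i. x (Suc i)) \<in> measurable Omega_algebra (Pi\<^sub>M UNIV (\<lambda>_. count_space {1, 2 :: nat}))"
    by (rule measurable_PiM_single', rule measurable_coordinate)
      (auto simp: space_Omega_algebra Omega_def)
  then show ?thesis
    by (simp add: shift_map_def[abs_def] Omega_algebra_def)
qed

text \<open>Deleting the first coordinate exchanges the roles of even and odd sites.\<close>

lemma distr_staggered_shift: "distr (staggered \<theta> c) Omega_algebra shift_map = staggered \<theta> (\<not> c)"
proof -
  have "staggered \<theta> (\<not> c) = (\<Pi>\<^sub>M i\<in>UNIV. site_measure \<theta> (even (Suc i) \<longleftrightarrow> c))"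
    unfolding staggered_def
    by (rule arg_cong[where f = "Pi\<^sub>M UNIV"], rule ext, rule arg_cong[where f = "site_measure \<theta>"]) auto
  also have "\<dots> = distr (staggered \<theta> c) (\<Pi>\<^sub>M i\<in>UNIV. site_measure \<theta> (even (Suc i) \<longleftrightarrow> c)) (\<lambda>x. \<lambda>i\<in>UNIV. x (Suc i))"
    unfolding staggered_def
    by (rule distr_PiM_reindex[symmetric, where f = Suc and K = UNIV]) (auto intro: prob_space_site_measure)
  also have "\<dots> = distr (staggered \<theta> c) Omega_algebra shift_map"
    by (rule distr_cong) (auto simp: shift_map_def Omega_algebra_def intro!: sets_PiM_cong)
  finally show ?thesis
    by simp
qed

lemma measure_staggered_shift:
  assumes "A \<in> sets Omega_algebra"
  shows "measure (staggered \<theta> c) (shift_map -` A \<inter> Omega) = measure (staggered \<theta> (\<not> c)) A"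
  using measure_distr[of shift_map "staggered \<theta> c" Omega_algebra A] measurable_shift_map assms
  by (simp add: distr_staggered_shift measurable_cong_sets[OF sets_staggered refl])

lemma indep_vars_staggered:
  "stag.indep_vars \<theta> c (\<lambda>k. site_measure \<theta> (even k \<longleftrightarrow> c)) (\<lambda>k x. x k) UNIV"
proof -
  have m: "(\<lambda>x. x k) \<in> measurable (staggered \<theta> c) (site_measure \<theta> (even k \<longleftrightarrow> c))" for k
    unfolding staggered_def by (rule measurable_component_singleton) simp
  have "distr (staggered \<theta> c) (site_measure \<theta> (even k \<longleftrightarrow> c)) (\<lambda>x. x k) = site_measure \<theta> (even k \<longleftrightarrow> c)" for k
    unfolding staggered_def by (rule distr_PiM_component) (auto intro: prob_space_site_measure)
  moreover have "distr (staggered \<theta> c) (\<Pi>\<^sub>M k\<in>UNIV. site_measure \<theta> (even k \<longleftrightarrow> c)) (\<lambda>x. \<lambda>k\<in>UNIV. x k)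
      = staggered \<theta> c"
    unfolding restrict_UNIV by (rule distr_id2) (simp add: staggered_def)
  ultimately show ?thesis
    unfolding stag.indep_vars_iff_distr_eq_PiM'[OF UNIV_not_empty m]
    by (simp only: staggered_def)
qed

lemma shift_map_funpow: "(shift_map ^^ n) x = (\<lambda>i. x (i + n))"
  by (induction n) (simp_all add: shift_map_def)

text \<open>An invariant set \<open>A\<close> equals its preimage under every power of the shift, so it belongs to the tail
  \<sigma>-algebra of independent coordinates and Kolmogorov's law applies.\<close>

lemma staggered_zero_one:
  assumes A: "A \<in> sets Omega_algebra" and inv: "shift_map -` A \<inter> Omega = A"
  shows "measure (staggered \<theta> c) A = 0 \<or> measure (staggered \<theta> c) A = 1"
proof -
  define F where "F k = sigma_sets Omega {(\<lambda>x :: nat \<Rightarrow> nat. x k) -` B \<inter> Omega | B. B \<in> Pow {1, 2}}" for k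
  have indep: "stag.indep_sets \<theta> c F UNIV"
    using indep_vars_staggered[of \<theta> c] unfolding stag.indep_vars_def F_def[abs_def] by simp
  have "A \<subseteq> Omega"
    using sets.sets_into_space[OF A] by (simp add: space_Omega_algebra)
  have shift: "shift_map x \<in> Omega" if "x \<in> Omega" for x
    using that by (simp add: Omega_def shift_map_def)
  have inv_n: "(shift_map ^^ n) x \<in> A \<longleftrightarrow> x \<in> A" if "x \<in> Omega" for n x
    using that
  proof (induction n arbitrary: x)
    case (Suc n)
    have "(shift_map ^^ Suc n) x \<in> A \<longleftrightarrow> shift_map x \<in> A"
      using Suc.IH[OF shift[OF Suc.prems]] by (simp add: funpow_Suc_right del: funpow.simps)
    also have "\<dots> \<longleftrightarrow> x \<in> A"
      using inv Suc.prems by auto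
    finally show ?case .
  qed simp
  have "A \<in> sigma_sets Omega (\<Union>k\<in>{n..}. F k)" for n
  proof -
    let ?G = "\<Union>k\<in>{n..}. F k"
    have G: "?G \<subseteq> Pow Omega"
    proof
      fix B assume "B \<in> ?G"
      then obtain k where "B \<in> F k"
        by blast
      then have "B \<subseteq> Omega"
        unfolding F_def by (rule sigma_sets_into_sp[rotated]) blast
      then show "B \<in> Pow Omega"
        by simp
    qed
    have coord: "(\<lambda>x. x (i + n)) \<in> measurable (sigma Omega ?G) (count_space {1, 2})" for i
    proof (rule measurableI)
      fix B assume "B \<in> sets (count_space {1, 2 :: nat})"
      then have "(\<lambda>x. x (i + n)) -` B \<inter> Omega \<in> F (i + n)"
        unfolding F_def by (intro sigma_sets.Basic) auto
      then show "(\<lambda>x. x (i + n)) -` B \<inter> space (sigma Omega ?G) \<in> sets (sigma Omega ?G)"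
        unfolding space_measure_of[OF G] sets_measure_of[OF G]
        by (intro sigma_sets.Basic UN_I[of "i + n"]) simp_all
    next
      fix x assume "x \<in> space (sigma Omega ?G)"
      then have "x \<in> Omega"
        using space_measure_of[OF G] by simp
      then show "x (i + n) \<in> space (count_space {1, 2})"
        by (simp add: Omega_def)
    qed
    have "(\<lambda>x i. x (i + n)) \<in> measurable (sigma Omega ?G) (Pi\<^sub>M UNIV (\<lambda>_. count_space {1, 2 :: nat}))"
      by (rule measurable_PiM_single', rule coord)
        (unfold space_measure_of[OF G], simp add: PiE_UNIV_domain Pi_iff Omega_def)
    then have "(shift_map ^^ n) \<in> measurable (sigma Omega ?G) Omega_algebra"
      by (simp add: shift_map_funpow[abs_def] Omega_algebra_def)
    then have "(shift_map ^^ n) -` A \<inter> Omega \<in> sets (sigma Omega ?G)"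
      using measurable_sets[OF _ A] space_measure_of[OF G] by metis
    also have "(shift_map ^^ n) -` A \<inter> Omega = A"
      using inv_n \<open>A \<subseteq> Omega\<close> by auto
    finally show ?thesis
      unfolding sets_measure_of[OF G] .
  qed
  then have "A \<in> stag.tail_events \<theta> c F"
    by (simp add: stag.tail_events_def)
  moreover have "sigma_algebra (space (staggered \<theta> c)) (F k)" for k
    unfolding F_def space_staggered by (rule sigma_algebra_sigma_sets) blast
  ultimately show ?thesis
    by (intro stag.kolmogorov_0_1_law[OF _ indep])
qed

section \<open>Mutual singularity of the two staggered measures\<close>

definition staggered_weight :: "real \<Rightarrow> bool \<Rightarrow> (nat \<Rightarrow> nat) \<Rightarrow> nat \<Rightarrow> real" where
  "staggered_weight \<theta> c x n = (\<Prod>k<n. local_prob \<theta> (even k \<longleftrightarrow> c) (x k))"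

lemma staggered_weight_nonneg: "0 \<le> staggered_weight \<theta> c x n"
  by (simp add: staggered_weight_def prod_nonneg local_prob_nonneg)

lemma staggered_weight_Suc:
  "staggered_weight \<theta> c x (Suc n) = local_prob \<theta> c (x 0) * staggered_weight \<theta> (\<not> c) (shift_map x) n"
proof -
  have "(even (Suc k) \<longleftrightarrow> c) = (even k \<longleftrightarrow> \<not> c)" for k
    by auto
  then show ?thesis
    unfolding staggered_weight_def prod.lessThan_Suc_shift by (simp only: shift_map_def even_zero simp_thms)
qed

text \<open>The Hellinger affinity of the two one-site distributions: for each \<open>j\<close> the product
  \<open>local_prob \<theta> b j * local_prob \<theta> (\<not> b) j\<close> equals \<open>(cos (2 * \<theta>) / 2)\<^sup>2\<close>. If a denominator vanishes,
  the corresponding term and the product are both \<open>0\<close>.\<close>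

lemma local_prob_overlap:
  "(\<Sum>j\<in>{1, 2}. local_prob \<theta> b j * sqrt (local_prob \<theta> (\<not> b) j / local_prob \<theta> b j)) = \<bar>cos (2 * \<theta>)\<bar>"
proof -
  have *: "p * sqrt (q / p) = sqrt (p * q)" if "0 \<le> p" for p q :: real
  proof (cases "p = 0")
    case False
    have "p * sqrt (q / p) = sqrt (p ^ 2) * sqrt (q / p)"
      using that by simp
    also have "\<dots> = sqrt (p ^ 2 * (q / p))"
      by (rule real_sqrt_mult[symmetric])
    also have "p ^ 2 * (q / p) = p * q"
      using False by (simp add: power2_eq_square)
    finally show ?thesis .
  qed simp
  have "local_prob \<theta> b j * local_prob \<theta> (\<not> b) j = (cos (2 * \<theta>) / 2) ^ 2" for j
    unfolding power_divide cos_squared_eq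
    by (simp add: local_prob_def spin_def field_simps power2_eq_square)
  then show ?thesis
    by (simp add: * local_prob_nonneg)
qed

text \<open>The square root of the likelihood ratio is a product of independent factors, each with mean equal
  to the one-site affinity.\<close>

lemma nn_integral_likelihood_ratio:
  "(\<integral>\<^sup>+ x. ennreal (sqrt (staggered_weight \<theta> (\<not> c) x n / staggered_weight \<theta> c x n)) \<partial>staggered \<theta> c)
    = ennreal (\<bar>cos (2 * \<theta>)\<bar> ^ n)"
proof -
  define r where "r b j = sqrt (local_prob \<theta> (\<not> b) j / local_prob \<theta> b j)" for b j
  have r: "0 \<le> r b j" for b j
    by (simp add: r_def local_prob_nonneg)
  have sqrt_prod: "sqrt (\<Prod>k<n. f k) = (\<Prod>k<n. sqrt (f k))" for f
    by (induction n) (simp_all add: real_sqrt_mult)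
  have factor: "sqrt (staggered_weight \<theta> (\<not> c) x n / staggered_weight \<theta> c x n)
      = (\<Prod>k<n. r (even k \<longleftrightarrow> c) (x k))" for x
  proof -
    have "(even k \<longleftrightarrow> \<not> c) = (\<not> (even k \<longleftrightarrow> c))" for k :: nat
      by auto
    then show ?thesis
      by (simp only: staggered_weight_def prod_dividef[symmetric] sqrt_prod r_def)
  qed
  have "stag.indep_vars \<theta> c (\<lambda>_. borel) (\<lambda>k x. ennreal (r (even k \<longleftrightarrow> c) (x k))) {..<n}"
    by (rule stag.indep_vars_compose2[OF stag.indep_vars_subset[OF indep_vars_staggered]])
      (auto simp: site_measure_def measurable_def space_point_measure sets_point_measure)
  then have "(\<integral>\<^sup>+ x. (\<Prod>k<n. ennreal (r (even k \<longleftrightarrow> c) (x k))) \<partial>staggered \<theta> c)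
      = (\<Prod>k<n. \<integral>\<^sup>+ x. ennreal (r (even k \<longleftrightarrow> c) (x k)) \<partial>staggered \<theta> c)"
    by (intro stag.indep_vars_nn_integral) auto
  also have "\<dots> = (\<Prod>k<n. ennreal \<bar>cos (2 * \<theta>)\<bar>)"
  proof (rule prod.cong[OF refl])
    fix k :: nat
    let ?S = "site_measure \<theta> (even k \<longleftrightarrow> c)"
    have m: "(\<lambda>x. x k) \<in> measurable (staggered \<theta> c) ?S"
      unfolding staggered_def by (rule measurable_component_singleton) simp
    have d: "distr (staggered \<theta> c) ?S (\<lambda>x. x k) = ?S"
      unfolding staggered_def by (rule distr_PiM_component) (auto intro: prob_space_site_measure)
    have "(\<integral>\<^sup>+ x. ennreal (r (even k \<longleftrightarrow> c) (x k)) \<partial>staggered \<theta> c)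
        = (\<integral>\<^sup>+ j. ennreal (r (even k \<longleftrightarrow> c) j) \<partial>distr (staggered \<theta> c) ?S (\<lambda>x. x k))"
      by (rule nn_integral_distr[OF m, symmetric])
        (auto simp: site_measure_def measurable_def space_point_measure sets_point_measure)
    also have "\<dots> = (\<Sum>j\<in>{1, 2}. ennreal (local_prob \<theta> (even k \<longleftrightarrow> c) j) * ennreal (r (even k \<longleftrightarrow> c) j))"
      unfolding d unfolding site_measure_def by (rule nn_integral_point_measure_finite) simp
    also have "\<dots> = ennreal (\<Sum>j\<in>{1, 2}. local_prob \<theta> (even k \<longleftrightarrow> c) j * r (even k \<longleftrightarrow> c) j)"
      by (subst sum_ennreal[symmetric]) (simp_all add: local_prob_nonneg r ennreal_mult)
    also have "\<dots> = ennreal \<bar>cos (2 * \<theta>)\<bar>"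
      unfolding r_def by (simp only: local_prob_overlap)
    finally show "(\<integral>\<^sup>+ x. ennreal (r (even k \<longleftrightarrow> c) (x k)) \<partial>staggered \<theta> c) = ennreal \<bar>cos (2 * \<theta>)\<bar>" .
  qed
  also have "\<dots> = ennreal (\<bar>cos (2 * \<theta>)\<bar> ^ n)"
    by (simp add: ennreal_power)
  finally show ?thesis
    by (simp add: factor prod_ennreal r)
qed

text \<open>The means of the square roots form a convergent geometric series, so the series of square roots
  converges almost surely and its terms tend to \<open>0\<close>.\<close>

lemma AE_likelihood_ratio_tendsto_0:
  assumes "\<bar>cos (2 * \<theta>)\<bar> < 1"
  shows "AE x in staggered \<theta> c.
    (\<lambda>n. staggered_weight \<theta> (\<not> c) x n / staggered_weight \<theta> c x n) \<longlonglongrightarrow> 0"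
proof -
  let ?g = "\<lambda>x n. sqrt (staggered_weight \<theta> (\<not> c) x n / staggered_weight \<theta> c x n)"
  have meas: "(\<lambda>x. ennreal (?g x n)) \<in> borel_measurable (staggered \<theta> c)" for n
  proof -
    have "(\<lambda>x. x k) \<in> measurable (staggered \<theta> c) (count_space {1, 2})" for k
      using measurable_coordinate[of k] by (simp only: measurable_cong_sets[OF sets_staggered refl])
    then have "(\<lambda>x. local_prob \<theta> b (x k)) \<in> borel_measurable (staggered \<theta> c)" for b k
      by (rule measurable_compose) simp
    then show ?thesis
      unfolding staggered_weight_def by measurable
  qed
  have "(\<integral>\<^sup>+ x. (\<Sum>n. ennreal (?g x n)) \<partial>staggered \<theta> c)
      = (\<Sum>n. \<integral>\<^sup>+ x. ennreal (?g x n) \<partial>staggered \<theta> c)"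
    by (rule nn_integral_suminf[OF meas])
  also have "\<dots> = (\<Sum>n. ennreal (\<bar>cos (2 * \<theta>)\<bar> ^ n))"
    by (simp only: nn_integral_likelihood_ratio)
  also have "\<dots> \<noteq> \<infinity>"
    using assms by (subst suminf_ennreal2) (simp_all add: summable_geometric)
  finally have "AE x in staggered \<theta> c. (\<Sum>n. ennreal (?g x n)) \<noteq> \<infinity>"
    by (intro nn_integral_PInf_AE borel_measurable_suminf_order meas)
  then show ?thesis
  proof eventually_elim
    case (elim x)
    have nonneg: "0 \<le> staggered_weight \<theta> (\<not> c) x n / staggered_weight \<theta> c x n" for n
      by (simp add: staggered_weight_nonneg)
    have "summable (?g x)"
      using elim nonneg by (intro summable_suminf_not_top) auto
    then have "(\<lambda>n. ?g x n ^ 2) \<longlonglongrightarrow> 0 ^ 2"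
      by (intro tendsto_power summable_LIMSEQ_zero)
    with nonneg show ?case
      by simp
  qed
qed

lemma tendsto_fun_eventually_eq:
  fixes y :: "nat \<Rightarrow> nat \<Rightarrow> 'a::topological_space"
  assumes "\<And>i m. i < m \<Longrightarrow> y m i = x i"
  shows "y \<longlonglongrightarrow> x"
proof -
  have "(\<lambda>m. y m i) \<longlonglongrightarrow> x i" for i
  proof (rule tendsto_eventually)
    show "\<forall>\<^sub>F m in sequentially. y m i = x i"
      using eventually_gt_at_top[of i] by eventually_elim (rule assms)
  qed
  then have "limitin (product_topology (\<lambda>_. euclidean) UNIV) y x sequentially"
    by (simp add: limitin_componentwise)
  then show ?thesis
    by (simp add: euclidean_product_topology)
qed

section \<open>Ergodic properties of the averaged measure\<close>

locale averaged_staggered = prob_space \<mu> for \<mu> :: "(nat \<Rightarrow> nat) measure" +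
  fixes \<theta> :: real
  assumes sets_\<mu>: "sets \<mu> = sets Omega_algebra"
    and average: "\<And>A. A \<in> sets Omega_algebra \<Longrightarrow>
      measure \<mu> A = (measure (staggered \<theta> True) A + measure (staggered \<theta> False) A) / 2"
begin

lemma space_\<mu>: "space \<mu> = Omega"
  using sets_eq_imp_space_eq[OF sets_\<mu>] by (simp add: space_Omega_algebra)

lemma invariant: "invariant_measure \<mu> shift_map"
  unfolding invariant_measure_def
proof (intro conjI ballI)
  show "shift_map \<in> measurable \<mu> \<mu>"
    using measurable_shift_map by (simp only: measurable_cong_sets[OF sets_\<mu> sets_\<mu>])
  fix A assume "A \<in> sets \<mu>"
  then have A: "A \<in> sets Omega_algebra"
    by (simp add: sets_\<mu>)
  then have A': "shift_map -` A \<inter> Omega \<in> sets Omega_algebra"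
    using measurable_sets[OF measurable_shift_map A] by (simp add: space_Omega_algebra)
  have "measure \<mu> (shift_map -` A \<inter> Omega) = measure \<mu> A"
    by (simp add: average A A' measure_staggered_shift)
  then show "emeasure \<mu> (shift_map -` A \<inter> space \<mu>) = emeasure \<mu> A"
    by (simp add: emeasure_eq_measure space_\<mu>)
qed

text \<open>The shift exchanges the two staggered measures, so they agree on an invariant set, and by the
  zero-one law their common value is \<open>0\<close> or \<open>1\<close>.\<close>

lemma ergodic: "ergodic_measure \<mu> shift_map"
  unfolding ergodic_measure_def
proof (intro conjI ballI impI invariant)
  fix A assume "A \<in> sets \<mu>" and "shift_map -` A \<inter> space \<mu> = A"
  then have A: "A \<in> sets Omega_algebra" and inv: "shift_map -` A \<inter> Omega = A"
    by (simp_all add: sets_\<mu> space_\<mu>)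
  have "measure (staggered \<theta> True) A = measure (staggered \<theta> False) A"
    using measure_staggered_shift[OF A, of \<theta> True] by (simp add: inv)
  then have "measure \<mu> A = measure (staggered \<theta> True) A"
    by (simp add: average[OF A])
  with staggered_zero_one[OF A inv] show "measure \<mu> A = 0 \<or> measure \<mu> A = 1"
    by simp
qed

text \<open>The outcomes at sites \<open>0\<close> and \<open>n\<close> have a correlation that depends only on the parity of \<open>n \<ge> 1\<close>.
  Convergence to \<open>1 / 4\<close> along even and along odd \<open>n\<close> would force both one-site distributions to
  be uniform.\<close>

lemma not_mixing:
  assumes "sin (2 * \<theta>) \<noteq> 0"
  shows "\<not> mixing_measure \<mu> shift_map"
proof
  assume mixing: "mixing_measure \<mu> shift_map"
  let ?A = "{x \<in> Omega. x 0 = 1}"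
  define p where "p c = local_prob \<theta> c 1" for c
  have A: "?A \<in> sets Omega_algebra" "measure \<mu> ?A = 1 / 2"
    using measure_staggered_coordinates[of "{0}" "\<lambda>_. 1"] local_prob_Not[of \<theta> True 1]
    by (simp_all add: average)
  have corr: "measure \<mu> ((shift_map ^^ n) -` ?A \<inter> ?A)
      = (p True * p (even n) + p False * p (odd n)) / 2" if "0 < n" for n
  proof -
    have "(shift_map ^^ n) -` ?A \<inter> ?A = {x \<in> Omega. \<forall>k\<in>{0, n}. x k = 1}"
    proof -
      have "(\<lambda>i. x (i + n)) \<in> Omega" if "x \<in> Omega" for x
        using that by (simp add: Omega_def)
      then show ?thesis
        by (auto simp: shift_map_funpow)
    qed
    with that show ?thesis
      using measure_staggered_coordinates[of "{0, n}" "\<lambda>_. 1"] by (simp add: average p_def)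
  qed
  have lim: "(\<lambda>n. measure \<mu> ((shift_map ^^ n) -` ?A \<inter> ?A)) \<longlonglongrightarrow> 1 / 2 * (1 / 2)"
    unfolding A(2)[symmetric]
    by (rule mixing[unfolded mixing_measure_def sets_\<mu>, THEN conjunct2, THEN bspec, THEN bspec]) (rule A(1))+
  \<comment> \<open>Along each parity class the correlation is constant.\<close>
  have "(\<lambda>m. measure \<mu> ((shift_map ^^ (2 * m + 2)) -` ?A \<inter> ?A)) \<longlonglongrightarrow> 1 / 2 * (1 / 2)"
    using LIMSEQ_subseq_LIMSEQ[OF lim, of "\<lambda>m. 2 * m + 2"] by (simp only: comp_def strict_mono_def) simp
  then have "(p True * p True + p False * p False) / 2 = 1 / 2 * (1 / 2)"
    by (subst (asm) corr) (simp_all add: LIMSEQ_const_iff)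
  moreover have "(\<lambda>m. measure \<mu> ((shift_map ^^ (2 * m + 1)) -` ?A \<inter> ?A)) \<longlonglongrightarrow> 1 / 2 * (1 / 2)"
    using LIMSEQ_subseq_LIMSEQ[OF lim, of "\<lambda>m. 2 * m + 1"] by (simp only: comp_def strict_mono_def) simp
  then have "(p True * p False + p False * p True) / 2 = 1 / 2 * (1 / 2)"
    by (subst (asm) corr) (simp_all add: LIMSEQ_const_iff)
  moreover have "p False = 1 - p True"
    using local_prob_Not[of \<theta> True 1] by (simp add: p_def)
  ultimately have "(2 * p True - 1)\<^sup>2 = 0"
    by (simp add: power2_eq_square algebra_simps)
  with assms show False
    by (simp add: p_def local_prob_def spin_def)
qed

lemma jacobian_quotient_eq:
  assumes x: "x \<in> Omega"
  shows "jacobian_quotient \<mu> x n =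
    (staggered_weight \<theta> True x (Suc n) + staggered_weight \<theta> False x (Suc n)) /
    (staggered_weight \<theta> True (shift_map x) n + staggered_weight \<theta> False (shift_map x) n)"
proof -
  have w: "measure \<mu> (cylinder (map y [0..<m])) = (staggered_weight \<theta> True y m + staggered_weight \<theta> False y m) / 2"
    if "y \<in> Omega" for y m
  proof -
    have "set (map y [0..<m]) \<subseteq> {1, 2}"
      using that by (auto simp: Omega_def)
    then show ?thesis
      by (simp add: average cylinder_in_sets measure_staggered_cylinder staggered_weight_def)
  qed
  have "map x [1..<Suc n] = map (shift_map x) [0..<n]"
    by (rule nth_equalityI) (simp_all add: shift_map_def del: upt_Suc)
  moreover have "shift_map x \<in> Omega"
    using x by (simp add: Omega_def shift_map_def)
  moreover have "(a / 2) / (b / 2) = a / b" for a b :: real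
    by simp
  ultimately show ?thesis
    using x by (simp only: jacobian_quotient_def w)
qed

lemma AE_staggered: "AE x in staggered \<theta> c. P x" if AE: "AE x in \<mu>. P x"
proof -
  obtain N where N: "{x \<in> space \<mu>. \<not> P x} \<subseteq> N" "emeasure \<mu> N = 0" "N \<in> sets \<mu>"
    using AE_E[OF AE] by blast
  then have N': "N \<in> sets Omega_algebra"
    by (simp add: sets_\<mu>)
  have "measure (staggered \<theta> True) N + measure (staggered \<theta> False) N = 0"
    using average[OF N'] N(2) by (simp add: emeasure_eq_measure)
  then have "measure (staggered \<theta> True) N = 0" "measure (staggered \<theta> False) N = 0"
    using measure_nonneg[of "staggered \<theta> True" N] measure_nonneg[of "staggered \<theta> False" N] by linarith+
  then have "measure (staggered \<theta> c) N = 0"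
    by (cases c) simp_all
  then show ?thesis
    using N(1) N' by (intro AE_I[of _ _ N]) (simp_all add: space_\<mu> stag.emeasure_eq_measure)
qed

text \<open>Under the staggered measure with flag \<open>c\<close>, the shifted sequence has flag \<open>\<not> c\<close>, so its weight for
  the flag \<open>\<not> c\<close> dominates. The quotient therefore tends to the probability of the first
  symbol in the ground state with flag \<open>c\<close>, although \<^term>\<open>\<mu>\<close> is a mixture of both.\<close>

lemma AE_jacobian_quotient:
  assumes s: "0 < \<bar>sin (2 * \<theta>)\<bar>" "\<bar>sin (2 * \<theta>)\<bar> < 1"
  shows "AE x in staggered \<theta> c. jacobian_quotient \<mu> x \<longlonglongrightarrow> local_prob \<theta> c (x 0)"
proof -
  have pos: "0 < staggered_weight \<theta> b x n" for b x n
    using s(2) by (auto simp: staggered_weight_def local_prob_def spin_def intro!: prod_pos)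
  have "(cos (2 * \<theta>))\<^sup>2 < 1\<^sup>2"
    using s(1) by (simp add: cos_squared_eq)
  then have "\<bar>cos (2 * \<theta>)\<bar> < 1"
    using power2_less_imp_less[of "\<bar>cos (2 * \<theta>)\<bar>" 1] by simp
  then have "AE x in distr (staggered \<theta> c) Omega_algebra shift_map.
      (\<lambda>n. staggered_weight \<theta> c x n / staggered_weight \<theta> (\<not> c) x n) \<longlonglongrightarrow> 0"
    unfolding distr_staggered_shift using AE_likelihood_ratio_tendsto_0[of \<theta> "\<not> c"] by simp
  then have "AE x in staggered \<theta> c.
      (\<lambda>n. staggered_weight \<theta> c (shift_map x) n / staggered_weight \<theta> (\<not> c) (shift_map x) n) \<longlonglongrightarrow> 0"
    by (rule AE_distrD[rotated])
      (simp only: measurable_cong_sets[OF sets_staggered refl] measurable_shift_map)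
  then show ?thesis
    using AE_space
  proof eventually_elim
    case (elim x)
    \<comment> \<open>Dividing by the dominant weight exhibits the quotient as a function of a ratio that tends to zero.\<close>
    define R where "R n = staggered_weight \<theta> c (shift_map x) n / staggered_weight \<theta> (\<not> c) (shift_map x) n" for n
    have "jacobian_quotient \<mu> x n = (local_prob \<theta> c (x 0) + local_prob \<theta> (\<not> c) (x 0) * R n) / (R n + 1)" for n
    proof -
      define a b where "a = staggered_weight \<theta> c (shift_map x) n"
        and "b = staggered_weight \<theta> (\<not> c) (shift_map x) n"
      have "0 < a" "0 < b"
        by (simp_all add: a_def b_def pos)
      have "jacobian_quotient \<mu> x n = (local_prob \<theta> c (x 0) * b + local_prob \<theta> (\<not> c) (x 0) * a) / (a + b)"
        using elim(2) by (cases c) (simp_all add: jacobian_quotient_eq staggered_weight_Suc a_def b_def add.commute)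
      also have "\<dots> = (local_prob \<theta> c (x 0) + local_prob \<theta> (\<not> c) (x 0) * (a / b)) / (a / b + 1)"
        using \<open>0 < a\<close> \<open>0 < b\<close> by (simp add: divide_simps)
      finally show ?thesis
        by (simp add: R_def a_def b_def)
    qed
    moreover have "R \<longlonglongrightarrow> 0"
      using elim(1) by (simp add: R_def[abs_def])
    then have "(\<lambda>n. (local_prob \<theta> c (x 0) + local_prob \<theta> (\<not> c) (x 0) * R n) / (R n + 1))
        \<longlonglongrightarrow> (local_prob \<theta> c (x 0) + local_prob \<theta> (\<not> c) (x 0) * 0) / (0 + 1)"
      by (intro tendsto_intros) auto
    ultimately show ?case
      by (simp add: fun_eq_iff[of "jacobian_quotient \<mu> x"] LIMSEQ_def)
  qed
qed

text \<open>Both staggered measures charge every cylinder, so every point is a limit of points where the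
  Jacobian takes the value dictated by the flag \<open>c\<close>, for either \<open>c\<close>. The two values differ, which
  excludes continuity at any point; the constant sequence \<open>1\<close> is as good as any other.\<close>

lemma not_has_continuous_jacobian_ae:
  assumes s: "0 < \<bar>sin (2 * \<theta>)\<bar>" "\<bar>sin (2 * \<theta>)\<bar> < 1"
  shows "\<not> has_continuous_jacobian_ae \<mu>"
proof
  assume "has_continuous_jacobian_ae \<mu>"
  then obtain J where J: "continuous_on Omega J" and AE: "AE x in \<mu>. jacobian_quotient \<mu> x \<longlonglongrightarrow> J x"
    by (auto simp: has_continuous_jacobian_ae_def)
  define x :: "nat \<Rightarrow> nat" where "x = (\<lambda>_. 1)"
  have x: "x \<in> Omega"
    by (simp add: x_def Omega_def)
  have J_eq: "J x = local_prob \<theta> c 1" for c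
  proof -
    have AE_J: "AE y in staggered \<theta> c. J y = local_prob \<theta> c (y 0)"
      using AE_staggered[OF AE, of c] AE_jacobian_quotient[OF s, of c]
      by eventually_elim (rule LIMSEQ_unique)
    have "\<exists>y\<in>Omega. (\<forall>i<m. y i = x i) \<and> J y = local_prob \<theta> c (y 0)" for m
    proof (rule ccontr)
      assume *: "\<not> ?thesis"
      have x12: "set (map x [0..<m]) \<subseteq> {1, 2}"
        by (auto simp: x_def)
      have "AE y in staggered \<theta> c. y \<notin> cylinder (map x [0..<m])"
        using AE_J by eventually_elim (use * in \<open>auto simp: cylinder_def\<close>)
      then have "cylinder (map x [0..<m]) \<in> null_sets (staggered \<theta> c)"
        using AE_iff_null_sets[of "cylinder (map x [0..<m])" "staggered \<theta> c"] cylinder_in_sets[OF x12]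
        by (simp only: sets_staggered)
      then have "measure (staggered \<theta> c) (cylinder (map x [0..<m])) = 0"
        by (rule measure_eq_0_null_sets)
      moreover have "0 < measure (staggered \<theta> c) (cylinder (map x [0..<m]))"
        unfolding measure_staggered_cylinder[OF x12] using s(2)
        by (auto simp: local_prob_def spin_def intro!: prod_pos)
      ultimately show False
        by simp
    qed
    then obtain y where y: "\<And>m. y m \<in> Omega" "\<And>i m. i < m \<Longrightarrow> y m i = x i"
      "\<And>m. J (y m) = local_prob \<theta> c (y m 0)"
      by metis
    have "(\<lambda>m. J (y m)) \<longlonglongrightarrow> J x"
      by (rule continuous_on_tendsto_compose[OF J tendsto_fun_eventually_eq x])
        (simp_all add: y(1,2))
    moreover have "(\<lambda>m. J (y m)) \<longlonglongrightarrow> local_prob \<theta> c 1"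
    proof (rule tendsto_eventually)
      show "\<forall>\<^sub>F m in sequentially. J (y m) = local_prob \<theta> c 1"
        using eventually_gt_at_top[of 0] by eventually_elim (simp add: y(2,3) x_def)
    qed
    ultimately show ?thesis
      by (rule LIMSEQ_unique)
  qed
  from J_eq[of True] J_eq[of False] s(1) show False
    by (simp add: local_prob_def spin_def)
qed

text \<open>Here \<^term>\<open>\<mu>\<close> is the average of two point masses on the alternating sequences. The quotients are
  eventually \<open>1\<close> along such a sequence \<open>x\<close>; they are eventually \<open>0\<close> along every sequence \<open>y m\<close> that
  follows \<open>x\<close> for \<open>m\<close> steps and then stays at \<open>1\<close>, since two equal adjacent symbols have
  probability \<open>0\<close>.\<close>

lemma not_has_continuous_jacobian_degenerate:
  assumes s: "sin (2 * \<theta>) = 1"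
  shows "\<not> has_continuous_jacobian \<mu>"
proof
  assume "has_continuous_jacobian \<mu>"
  then obtain J where J: "continuous_on Omega J"
    and lim: "\<And>x. x \<in> Omega \<Longrightarrow> jacobian_quotient \<mu> x \<longlonglongrightarrow> J x"
    by (auto simp: has_continuous_jacobian_def)
  have p: "local_prob \<theta> b j = (if b = (j \<noteq> 1) then 1 else 0)" for b j
    by (auto simp: local_prob_def spin_def s)
  define x :: "nat \<Rightarrow> nat" where "x k = (if even k then 1 else 2)" for k
  define y :: "nat \<Rightarrow> nat \<Rightarrow> nat" where "y m k = (if k < m then x k else 1)" for m k
  have x: "x \<in> Omega" and y: "y m \<in> Omega" for m
    by (auto simp: Omega_def x_def y_def)
  have "J x = 1"
  proof (rule LIMSEQ_unique[OF lim[OF x]], rule tendsto_eventually)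
    have T: "staggered_weight \<theta> True x (Suc n) = 0" "staggered_weight \<theta> False x n = 1" for n
      by (auto simp: staggered_weight_def p x_def intro!: prod_zero prod.neutral bexI[of _ 0])
    have quotient: "jacobian_quotient \<mu> x (Suc n) = 1" for n
      using T(2)[of "Suc (Suc n)"] T(1)[of "Suc n"]
        staggered_weight_Suc[of \<theta> False x "Suc n"]
      by (simp add: jacobian_quotient_eq[OF x] T p x_def[of 0])
        (auto simp: staggered_weight_def p x_def shift_map_def intro!: prod_zero bexI[of _ 0])
    show "\<forall>\<^sub>F n in sequentially. jacobian_quotient \<mu> x n = 1"
      using eventually_gt_at_top[of 0] by eventually_elim (metis gr0_implies_Suc quotient)
  qed
  moreover have "J (y m) = 0" for m
  proof (rule LIMSEQ_unique[OF lim[OF y]], rule tendsto_eventually)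
    have zero: "staggered_weight \<theta> c (y m) (Suc n) = 0" if "m < n" for c n
    proof -
      \<comment> \<open>One of two adjacent equal symbols has the wrong parity for the flag.\<close>
      define k where "k = (if even m = c then m else Suc m)"
      have "k < Suc n" "local_prob \<theta> (even k \<longleftrightarrow> c) (y m k) = 0"
        using that by (auto simp: k_def p y_def)
      then show ?thesis
        unfolding staggered_weight_def by (intro prod_zero) auto
    qed
    show "\<forall>\<^sub>F n in sequentially. jacobian_quotient \<mu> (y m) n = 0"
      using eventually_gt_at_top[of m]
      by eventually_elim (simp add: jacobian_quotient_eq[OF y] zero)
  qed
  moreover have "(\<lambda>m. J (y m)) \<longlonglongrightarrow> J x"
    by (rule continuous_on_tendsto_compose[OF J tendsto_fun_eventually_eq x])
      (simp_all add: y, simp add: y_def)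
  ultimately show False
    by (simp add: LIMSEQ_const_iff)
qed

end

section \<open>The zero-temperature measure\<close>

lemma averaged_staggered_of_ground_weight:
  assumes "prob_space \<mu>" and sets: "sets \<mu> = sets Omega_algebra"
    and ground: "\<And>js. 2 \<le> length js \<Longrightarrow> set js \<subseteq> {1, 2} \<Longrightarrow>
      complex_of_real (measure \<mu> (cylinder js)) = ground_weight \<theta> js"
  shows "averaged_staggered \<mu> \<theta>"
proof -
  have "measure \<mu> (cylinder js) =
      (measure (staggered \<theta> True) (cylinder js) + measure (staggered \<theta> False) (cylinder js)) / 2"
    if js: "2 \<le> length js" "set js \<subseteq> {1, 2}" for js
  proof -
    have "measure \<mu> (cylinder js) = ((\<Prod>k<length js. local_prob \<theta> (even k) (js ! k)) +
        (\<Prod>k<length js. local_prob \<theta> (odd k) (js ! k))) / 2"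
      using ground[OF js] unfolding ground_weight_eq[OF js(2,1)] of_real_eq_iff .
    then show ?thesis
      by (simp add: measure_staggered_cylinder[OF js(2)])
  qed
  from measure_eq_staggered_average[OF assms(1) sets this] show ?thesis
    using assms(1) sets by (simp add: averaged_staggered_def averaged_staggered_axioms_def)
qed

theorem theorem1:
  fixes \<theta> :: real and \<mu> :: "(nat \<Rightarrow> nat) measure"
  assumes "0 < \<theta>" and "\<theta> < pi / 2"
    and "prob_space \<mu>" and "sets \<mu> = sets Omega_algebra"
    and "\<And>n js. n \<ge> 2 \<Longrightarrow> length js = n \<Longrightarrow> set js \<subseteq> {1, 2} \<Longrightarrow>
           complex_of_real (measure \<mu> (cylinder js)) = ground_weight \<theta> js"
  shows "invariant_measure \<mu> shift_map \<and> ergodic_measure \<mu> shift_map \<and>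
    \<not> mixing_measure \<mu> shift_map \<and>
    \<not> has_continuous_jacobian \<mu> \<and>
    (\<theta> \<noteq> pi / 4 \<longrightarrow> \<not> has_continuous_jacobian_ae \<mu>)"
proof -
  interpret averaged_staggered \<mu> \<theta>
    using assms(5) by (intro averaged_staggered_of_ground_weight assms(3,4)) blast
  have sin_pos: "0 < sin (2 * \<theta>)"
    using assms(1,2) by (intro sin_gt_zero) auto
  have ae: "\<not> has_continuous_jacobian_ae \<mu>" if "\<theta> \<noteq> pi / 4"
  proof -
    have "sin (2 * \<theta>) \<noteq> 1"
    proof
      assume "sin (2 * \<theta>) = 1"
      then have "cos (2 * \<theta>) = cos (pi / 2)"
        using sin_cos_squared_add[of "2 * \<theta>"] by simp
      then have "2 * \<theta> = pi / 2"
        by (rule cos_inj_pi[rotated 4]) (use assms(1,2) in auto)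
      with that show False
        by simp
    qed
    with sin_pos have "0 < \<bar>sin (2 * \<theta>)\<bar>" "\<bar>sin (2 * \<theta>)\<bar> < 1"
      using sin_le_one[of "2 * \<theta>"] by linarith+
    then show ?thesis
      by (rule not_has_continuous_jacobian_ae)
  qed
  have "\<not> has_continuous_jacobian \<mu>"
  proof (cases "\<theta> = pi / 4")
    case True
    then have "2 * \<theta> = pi / 2"
      by simp
    then have "sin (2 * \<theta>) = 1"
      by (simp only: sin_pi_half)
    then show ?thesis
      by (rule not_has_continuous_jacobian_degenerate)
  next
    case False
    have "has_continuous_jacobian_ae \<mu>" if "has_continuous_jacobian \<mu>"
    proof -
      from that obtain J where "continuous_on Omega J" "\<forall>x\<in>Omega. jacobian_quotient \<mu> x \<longlonglongrightarrow> J x"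
        unfolding has_continuous_jacobian_def by blast
      then show ?thesis
        unfolding has_continuous_jacobian_ae_def
        by (intro exI[of _ J] conjI AE_I2) (simp_all add: space_\<mu>)
    qed
    with ae[OF False] show ?thesis
      by blast
  qed
  then show ?thesis
    using invariant ergodic not_mixing sin_pos ae by simp
qed

end
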